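(* Let $\Omega\subset\mathbf{R}^2$ be an open bounded domain with Lipschitz boundary, let $\mathcal{T}_h(\Omega)$ be a triangulation of $\Omega$ of mesh size $h$, and let $\mu,\alpha,\beta>0$ be fixed parameters such that $\mu+\alpha+\beta=1$. Let $f_1,\dots,f_6:[0,1]\to\mathbf{R}$ be integrable functions, each of constant sign, with $f_\ell\ne 0$ almost everywhere and $f_\ell(0)=0$ for $\ell=1,\dots,6$. For any $E\in\mathcal{T}_h(\Omega)$, consider the enriched finite element relative to the (admissible) enrichment functions $$\widetilde{\lambda}_k^E(\mathbf{x})=\omega^E_{\mu,\alpha,\beta}(\mathbf{x})\,f_{2k-1}\left(\lambda_{k+1}^E(\mathbf{x})\right)f_{2k}\left(\lambda_{k+2}^E(\mathbf{x})\right),\qquad k=1,2,3,$$ and let $\Pi_h^{\mathrm{enr}}$ be the corresponding global enriched projector. Then, for any $g\in C^{1,1}(\Omega)$, $$\left\lVert g-\Pi_h^{\mathrm{enr}}[g]\right\rVert_{L^2(\Omega)}\le \mathcal{C}_{\mu,\alpha,\beta}\,h^2,$$ where $$\mathcal{C}_{\mu,\alpha,\beta}=\frac{L(\nabla g)}{8}\left(1+\frac{9(\mu+1)K^2}{2}H_{\alpha,\beta}\right)\sqrt{|\Omega|},$$ $$K=\max_{\ell=1,\dots,6}\lVert f_\ell\rVert_{L^\infty([0,1])},\qquad H_{\alpha,\beta}=\max_{i=1,2,3}\left|\int_0^1 t^{\alpha}(1-t)^{\beta}f_{2i-1}(t)f_{2i}(1-t)\,dt\right|^{-1}.$$ In particular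 $\mathcal{C}_{\mu,\alpha,\beta}$ depends only on the parameters $\mu,\alpha,\beta$, the enrichment functions, the function $g$ and the domain $\Omega$.
   Context: Mesh. $\mathcal{T}_h(\Omega)$ is a finite collection of nonoverlapping (closed, nondegenerate) triangles covering $\Omega$ (their union is $\overline{\Omega}$), with $h_E$ the diameter of $E$ and $h=\max_{E}h_E$; the mesh is regular, i.e. $h_E/\varrho_E\le\delta$ for all $E$ and some $\delta>0$, where $\varrho_E$ is the diameter of the circle inscribed in $E$. $|\Omega|$ denotes the area of $\Omega$. Triangle notation. $E$ has vertices $\mathbf{v}_1^E,\mathbf{v}_2^E,\mathbf{v}_3^E$; $\mathbf{e}_j^E$ is the edge opposite to $\mathbf{v}_j^E$, of length $|\mathbf{e}_j^E|$. The barycentric coordinates $\lambda_i^E$ are the affine functions with $\lambda_i^E(\mathbf{v}_j^E)=\delta_{ij}$; indices are cyclic modulo 3 ($\lambda_4^E=\lambda_1^E$, $\lambda_5^E=\lambda_2^E$). A function has constant sign if it is everywhere $\ge0$ or everywhere $\le 0$. Weight function. $\omega^E_{\mu,\alpha,\beta}(\mathbf{x})=\sum_{j=1}^{3}(1-\lambda_j^E(\mathbf{x}))^{\mu}(\lambda_{j+1}^E(\mathbf{x}))^{\alpha}(\lambda_{j+2}^E(\mathbf{x}))^{\beta}$. Enriched element. $\mathcal{L}_i(v)=v(\mathbf{v}_i^E)$ and $\widetilde{\mathcal{L}}_j(v)=\frac{1}{|\mathbf{e}_j^E|}\int_{\mathbf{e}_j^E}v\,d\mathbf{x}$ (arc-length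 integral), $i,j=1,2,3$; these functionals are assumed to be well defined on the local enriched space $V_h(E)=P^1(E)\oplus\operatorname{span}\{\widetilde{\lambda}_1^E,\widetilde{\lambda}_2^E,\widetilde{\lambda}_3^E\}$, where $P^1(E)$ is the space of polynomials of degree at most one. Admissibility of the enrichment functions means that $\dim V_h(E)=6$ (with direct sum) and $V_h(E)$ has a (necessarily unique) basis $\varphi_1^E,\dots,\varphi_6^E$ with $\mathcal{L}_r(\varphi_i^E)=\delta_{ir}$, $\widetilde{\mathcal{L}}_s(\varphi_i^E)=0$, $\mathcal{L}_r(\varphi_{j+3}^E)=0$, $\widetilde{\mathcal{L}}_s(\varphi_{j+3}^E)=\delta_{js}$ for $i,j,r,s\in\{1,2,3\}$. Projectors. The local enriched projector is $\pi_h^{\mathrm{enr}}[g]=\sum_{i=1}^3\mathcal{L}_i(g)\varphi_i^E+\sum_{i=1}^3\widetilde{\mathcal{L}}_i(g)\varphi_{i+3}^E$ for $g\in C^0(E)$, and the global one is defined elementwise by $\Pi_h^{\mathrm{enr}}[g]|_E=\pi_h^{\mathrm{enr}}[g|_E]$ for all $E\in\mathcal{T}_h(\Omega)$. Function class. $C^{1,1}(\Omega)$ is the set of continuously differentiable functions $g$ on $\Omega$ whose gradient is Lipschitz continuous on $\Omega$ in the Euclidean norm; $L(\nabla g)$ is the smallest $\rho$ with $\|\nabla g(\mathbf{x}_1)-\nabla g(\mathbf{x}_2)\|\le\rho\|\mathbf{x}_1-\mathbf{x}_2\|$ for all $\mathbf{x}_1,\mathbf{x}_2\in\Omega$. Such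 $g$ is identified with its continuous extension to $\overline\Omega$. *)

theory Defs
  imports
    "HOL-Probability.Essential_Supremum"
    "HOL-Library.Function_Algebras"
begin

section \<open>Domains, triangles and meshes\<close>

type_synonym point = "real ^ 2"

text \<open>Near every boundary point, and after a rotation of the axes onto the orthonormal frame
  \<open>u, w\<close>, the domain is the strict epigraph of a Lipschitz function.\<close>

definition lipschitz_boundary :: "point set \<Rightarrow> bool" where
  "lipschitz_boundary \<Omega> \<longleftrightarrow>
    (\<forall>p\<in>frontier \<Omega>. \<exists>r>0. \<exists>u w :: point. \<exists>\<gamma> :: real \<Rightarrow> real.
       norm u = 1 \<and> norm w = 1 \<and> u \<bullet> w = 0 \<and>
       (\<exists>M. M-lipschitz_on UNIV \<gamma>) \<and>
       \<Omega> \<inter> ball p r = {x \<in> ball p r. \<gamma> (x \<bullet> u) < x \<bullet> w})"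

definition lipschitz_domain :: "point set \<Rightarrow> bool" where
  "lipschitz_domain \<Omega> \<longleftrightarrow>
     open \<Omega> \<and> connected \<Omega> \<and> \<Omega> \<noteq> {} \<and> bounded \<Omega> \<and> lipschitz_boundary \<Omega>"

datatype triangle = Triangle point point point

text \<open>Vertices are numbered 1, 2, 3, and the numbering is cyclic modulo 3.\<close>

fun vertex :: "triangle \<Rightarrow> nat \<Rightarrow> point" where
  "vertex (Triangle a b c) j = (if j mod 3 = 1 then a else if j mod 3 = 2 then b else c)"

definition region :: "triangle \<Rightarrow> point set" where
  "region E = convex hull (vertex E ` {1..3})"

definition edge :: "triangle \<Rightarrow> nat \<Rightarrow> point set" where
  "edge E j = closed_segment (vertex E (j + 1)) (vertex E (j + 2))"

definition edge_length :: "triangle \<Rightarrow> nat \<Rightarrow> real" where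
  "edge_length E j = dist (vertex E (j + 1)) (vertex E (j + 2))"

definition nondegenerate :: "triangle \<Rightarrow> bool" where
  "nondegenerate E \<longleftrightarrow> \<not> collinear (vertex E ` {1..3})"

text \<open>The inscribed circle bounds the disc that is contained in the triangle and touches all
  three edges.\<close>

definition incircle_diameter :: "triangle \<Rightarrow> real" where
  "incircle_diameter E =
     (THE d. \<exists>c. cball c (d / 2) \<subseteq> region E \<and> (\<forall>j\<in>{1..3}. cball c (d / 2) \<inter> edge E j \<noteq> {}))"

definition regular_mesh :: "point set \<Rightarrow> triangle set \<Rightarrow> bool" where
  "regular_mesh \<Omega> T \<longleftrightarrow>
     finite T \<and>
     (\<forall>E\<in>T. nondegenerate E) \<and>
     (\<forall>E\<in>T. \<forall>E'\<in>T. E \<noteq> E' \<longrightarrow> interior (region E) \<inter> interior (region E') = {}) \<and>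
     (\<Union>E\<in>T. region E) = closure \<Omega> \<and>
     (\<exists>\<delta>>0. \<forall>E\<in>T. diameter (region E) / incircle_diameter E \<le> \<delta>)"

definition mesh_size :: "triangle set \<Rightarrow> real" where
  "mesh_size T = (MAX E\<in>T. diameter (region E))"

definition barycentric :: "triangle \<Rightarrow> nat \<Rightarrow> point \<Rightarrow> real" where
  "barycentric E i =
     (THE l. (\<exists>a b. l = (\<lambda>x. a + b \<bullet> x)) \<and>
             (\<forall>j\<in>{1..3}. l (vertex E j) = (if j mod 3 = i mod 3 then 1 else 0)))"


section \<open>The enriched element\<close>

text \<open>A function on a set \<open>S\<close> is represented by its extension by zero, so that two functions
  that agree on \<open>S\<close> are equal.\<close>

definition on_set :: "point set \<Rightarrow> (point \<Rightarrow> real) \<Rightarrow> point \<Rightarrow> real" where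
  "on_set S v = (\<lambda>x. if x \<in> S then v x else 0)"

interpretation fun_space: vector_space "\<lambda>(c :: real) (v :: point \<Rightarrow> real) x. c * v x"
  by unfold_locales (auto simp: algebra_simps fun_eq_iff)

definition P1 :: "triangle \<Rightarrow> (point \<Rightarrow> real) set" where
  "P1 E = {on_set (region E) (\<lambda>x. a + b \<bullet> x) | a b. True}"

text \<open>In what follows \<open>e 1\<close>, \<open>e 2\<close>, \<open>e 3\<close> are the enrichment functions of the element \<open>E\<close>.\<close>

definition enrichment_span :: "triangle \<Rightarrow> (nat \<Rightarrow> point \<Rightarrow> real) \<Rightarrow> (point \<Rightarrow> real) set" where
  "enrichment_span E e = fun_space.span ((\<lambda>k. on_set (region E) (e k)) ` {1..3})"

definition enriched_space :: "triangle \<Rightarrow> (nat \<Rightarrow> point \<Rightarrow> real) \<Rightarrow> (point \<Rightarrow> real) set" where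
  "enriched_space E e = {p + q | p q. p \<in> P1 E \<and> q \<in> enrichment_span E e}"

definition vertex_value :: "triangle \<Rightarrow> nat \<Rightarrow> (point \<Rightarrow> real) \<Rightarrow> real" where
  "vertex_value E i v = v (vertex E i)"

text \<open>Edges are parametrised over \<open>[0, 1]\<close> with constant speed \<open>edge_length E j\<close>.\<close>

definition edge_integrable :: "triangle \<Rightarrow> nat \<Rightarrow> (point \<Rightarrow> real) \<Rightarrow> bool" where
  "edge_integrable E j v \<longleftrightarrow>
     set_integrable lebesgue {0..1} (\<lambda>t. v (linepath (vertex E (j + 1)) (vertex E (j + 2)) t))"

definition edge_integral :: "triangle \<Rightarrow> nat \<Rightarrow> (point \<Rightarrow> real) \<Rightarrow> real" where
  "edge_integral E j v =
     (LINT t:{0..1}|lebesgue. v (linepath (vertex E (j + 1)) (vertex E (j + 2)) t) * edge_length E j)"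

definition edge_mean :: "triangle \<Rightarrow> nat \<Rightarrow> (point \<Rightarrow> real) \<Rightarrow> real" where
  "edge_mean E j v = 1 / edge_length E j * edge_integral E j v"

definition functionals_well_defined :: "triangle \<Rightarrow> (nat \<Rightarrow> point \<Rightarrow> real) \<Rightarrow> bool" where
  "functionals_well_defined E e \<longleftrightarrow>
     (\<forall>v\<in>enriched_space E e. \<forall>j\<in>{1..3}. edge_integrable E j v)"

text \<open>Only the values of \<open>\<phi>\<close> at the indices 1 to 6 are relevant.\<close>

definition dual_basis ::
  "triangle \<Rightarrow> (nat \<Rightarrow> point \<Rightarrow> real) \<Rightarrow> (nat \<Rightarrow> point \<Rightarrow> real) \<Rightarrow> bool" where
  "dual_basis E e \<phi> \<longleftrightarrow>
     inj_on \<phi> {1..6} \<and>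
     \<not> fun_space.dependent (\<phi> ` {1..6}) \<and>
     fun_space.span (\<phi> ` {1..6}) = enriched_space E e \<and>
     (\<forall>i\<in>{1..3}. \<forall>r\<in>{1..3}.
        vertex_value E r (\<phi> i) = (if i = r then 1 else 0) \<and>
        edge_mean E r (\<phi> i) = 0 \<and>
        vertex_value E r (\<phi> (i + 3)) = 0 \<and>
        edge_mean E r (\<phi> (i + 3)) = (if i = r then 1 else 0))"

definition admissible :: "triangle \<Rightarrow> (nat \<Rightarrow> point \<Rightarrow> real) \<Rightarrow> bool" where
  "admissible E e \<longleftrightarrow>
     P1 E \<inter> enrichment_span E e = {0} \<and>
     fun_space.dim (enriched_space E e) = 6 \<and>
     (\<exists>\<phi>. dual_basis E e \<phi>)"

definition enriched_basis ::
  "triangle \<Rightarrow> (nat \<Rightarrow> point \<Rightarrow> real) \<Rightarrow> nat \<Rightarrow> point \<Rightarrow> real" where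
  "enriched_basis E e = (SOME \<phi>. dual_basis E e \<phi>)"

definition local_projector ::
  "triangle \<Rightarrow> (nat \<Rightarrow> point \<Rightarrow> real) \<Rightarrow> (point \<Rightarrow> real) \<Rightarrow> point \<Rightarrow> real" where
  "local_projector E e g x =
     (\<Sum>i=1..3. vertex_value E i g * enriched_basis E e i x) +
     (\<Sum>i=1..3. edge_mean E i g * enriched_basis E e (i + 3) x)"

text \<open>The elementwise projections may disagree on the edges shared by two triangles, so the global
  projection of \<open>g\<close> is determined only up to a null set. Here \<open>e E\<close> are the enrichment functions
  of the element \<open>E\<close>.\<close>

definition is_global_projection ::
  "triangle set \<Rightarrow> (triangle \<Rightarrow> nat \<Rightarrow> point \<Rightarrow> real) \<Rightarrow> (point \<Rightarrow> real) \<Rightarrow> (point \<Rightarrow> real) \<Rightarrow> bool" where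
  "is_global_projection T e g \<Pi>g \<longleftrightarrow>
     (\<forall>E\<in>T. AE x in lebesgue_on (region E). \<Pi>g x = local_projector E (e E) g x)"


section \<open>The enrichment functions\<close>

definition weight :: "real \<Rightarrow> real \<Rightarrow> real \<Rightarrow> triangle \<Rightarrow> point \<Rightarrow> real" where
  "weight \<mu> \<alpha> \<beta> E x =
     (\<Sum>j=1..3. (1 - barycentric E j x) powr \<mu> * barycentric E (j + 1) x powr \<alpha>
                  * barycentric E (j + 2) x powr \<beta>)"

definition enrichment ::
  "real \<Rightarrow> real \<Rightarrow> real \<Rightarrow> (nat \<Rightarrow> real \<Rightarrow> real) \<Rightarrow> triangle \<Rightarrow> nat \<Rightarrow> point \<Rightarrow> real" where
  "enrichment \<mu> \<alpha> \<beta> f E k x =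
     weight \<mu> \<alpha> \<beta> E x * f (2 * k - 1) (barycentric E (k + 1) x) * f (2 * k) (barycentric E (k + 2) x)"


section \<open>Function class, norms and constants\<close>

definition grad :: "(point \<Rightarrow> real) \<Rightarrow> point \<Rightarrow> point" where
  "grad g x = (THE D. GDERIV g x :> D)"

definition C11 :: "point set \<Rightarrow> (point \<Rightarrow> real) \<Rightarrow> bool" where
  "C11 \<Omega> g \<longleftrightarrow>
     (\<forall>x\<in>\<Omega>. \<exists>D. GDERIV g x :> D) \<and>
     continuous_on \<Omega> (grad g) \<and>
     (\<exists>\<rho>. \<rho>-lipschitz_on \<Omega> (grad g))"

definition lipschitz_const :: "point set \<Rightarrow> (point \<Rightarrow> point) \<Rightarrow> real" where
  "lipschitz_const \<Omega> G = (LEAST \<rho>. \<rho>-lipschitz_on \<Omega> G)"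

text \<open>The continuous extension to the closure.\<close>

definition closure_ext :: "point set \<Rightarrow> (point \<Rightarrow> real) \<Rightarrow> point \<Rightarrow> real" where
  "closure_ext \<Omega> g x = (if x \<in> \<Omega> then g x else Lim (at x within \<Omega>) g)"

text \<open>The value is infinite for functions that are not (Lebesgue measurable and) square
  integrable.\<close>

definition L2_norm :: "point set \<Rightarrow> (point \<Rightarrow> real) \<Rightarrow> ennreal" where
  "L2_norm S u =
     (if set_integrable lebesgue S (\<lambda>x. (u x)\<^sup>2) \<and> set_borel_measurable lebesgue S u
      then ennreal (sqrt (LINT x:S|lebesgue. (u x)\<^sup>2)) else top)"

text \<open>An integrable function need not be essentially bounded, so this may be infinite, and the
  constant of the error estimate is then an extended nonnegative real.\<close>

definition K_const :: "(nat \<Rightarrow> real \<Rightarrow> real) \<Rightarrow> ennreal" where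
  "K_const f = (MAX l\<in>{1..6}. esssup (lebesgue_on {0..1}) (\<lambda>t. ennreal \<bar>f l t\<bar>))"

definition H_const :: "real \<Rightarrow> real \<Rightarrow> (nat \<Rightarrow> real \<Rightarrow> real) \<Rightarrow> real" where
  "H_const \<alpha> \<beta> f =
     (MAX i\<in>{1..3}. inverse \<bar>LINT t:{0..1}|lebesgue.
        t powr \<alpha> * (1 - t) powr \<beta> * f (2 * i - 1) t * f (2 * i) (1 - t)\<bar>)"

definition C_const ::
  "real \<Rightarrow> real \<Rightarrow> real \<Rightarrow> (nat \<Rightarrow> real \<Rightarrow> real) \<Rightarrow> (point \<Rightarrow> real) \<Rightarrow> point set \<Rightarrow> ennreal" where
  "C_const \<mu> \<alpha> \<beta> f g \<Omega> =
     ennreal (lipschitz_const \<Omega> (grad g) / 8) *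
     (1 + ennreal (9 * (\<mu> + 1) / 2) * (K_const f)\<^sup>2 * ennreal (H_const \<alpha> \<beta> f)) *
     ennreal (sqrt (measure lebesgue \<Omega>))"

end

theory Submission
  imports Defs
begin

text \<open>
  The error is estimated pointwise almost everywhere, and the pointwise bound is integrated over
  \<open>\<Omega>\<close>.

  Because all \<open>f l\<close> vanish at 0, the enrichment function with index \<open>k\<close> vanishes at the vertices
  and on the two edges other than edge \<open>k\<close>. The six degrees of freedom therefore decouple: the
  vertex values fix the affine part of an element of the enriched space, and then the mean over
  edge \<open>k\<close> fixes the coefficient of the \<open>k\<close>-th enrichment function
  (\<open>enriched_space_reproduction\<close>). Consequently the local projection of \<open>g\<close> is the linear
  interpolant plus the sum of \<open>d k / I k\<close> times the \<open>k\<close>-th enrichment function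
  (\<open>local_projector_enrichment\<close>). Here \<open>d k\<close> is the error of the trapezoidal rule for the mean
  over edge \<open>k\<close>, and \<open>I k\<close> is the integral that occurs in \<open>H_const\<close>; it is nonzero since its
  integrand has constant sign and vanishes only on a null set.

  Write \<open>L\<close> for the Lipschitz constant of the gradient and \<open>h\<close> for the mesh size. Everything is
  controlled by one inequality: along a segment, \<open>g\<close> deviates from its chord by at most \<open>L / 8\<close>
  times the squared length (\<open>chord_error\<close>). Averaged over an edge, it bounds \<open>d k\<close> by
  \<open>L h\<^sup>2 / 8\<close>. Applied twice, first to a segment from a vertex to the opposite edge and then to that
  edge, it bounds the error of linear interpolation by \<open>2 L h\<^sup>2 / 8\<close>. As the weighted inequality of
  the arithmetic and geometric means bounds the weight function by \<open>\<mu> + 1\<close>, the total error is at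
  most \<open>L h\<^sup>2 / 8 (2 + 3 (\<mu> + 1) K\<^sup>2 H)\<close>. Finally \<open>\<bar>I k\<bar> \<le> K\<^sup>2\<close> gives \<open>K\<^sup>2 H \<ge> 1\<close>, so that the
  surplus in the first summand is absorbed by the second and the constant
  \<open>1 + 9 (\<mu> + 1) K\<^sup>2 H / 2\<close> results.

  The gradient is controlled on \<open>\<Omega>\<close> only, while the triangles lie in its closure. A Lipschitz domain
  is the interior of its closure, so the interiors of the triangles lie in \<open>\<Omega>\<close>; there the chord
  inequality holds, and it passes to the closed triangles because \<open>g\<close> extends continuously to the
  closure (\<open>limit_at_frontier\<close>). The functions \<open>f l\<close> are merely Lebesgue measurable; that their
  compositions with barycentric coordinates are measurable and essentially bounded (for finite \<open>K_const f\<close>) rests on the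
  fact that preimages of null sets under these coordinates are null sets (\<open>AE_barycentric\<close>).

  When \<open>K_const f\<close> is infinite, so is the right-hand side, except if \<open>L = 0\<close>. In that case
  the estimates above give a vanishing error whatever the enrichment functions are.
\<close>


section \<open>Barycentric coordinates\<close>

(* Indices of vertices and edges are numerals, and 1 is kept among them. *)
declare One_nat_def [simp del]

definition cross2 :: "point \<Rightarrow> point \<Rightarrow> real" where
  "cross2 u v = u $ 1 * v $ 2 - u $ 2 * v $ 1"

lemma inner_point: "(u :: point) \<bullet> v = u $ 1 * v $ 1 + u $ 2 * v $ 2"
  by (simp add: inner_vec_def sum_2)

lemma point_eq_iff: "(u :: point) = v \<longleftrightarrow> u $ 1 = v $ 1 \<and> u $ 2 = v $ 2"
  by (simp add: vec_eq_iff forall_2)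

text \<open>The cross product is the determinant of the linear system for an affine function with
  prescribed values at \<open>a\<close>, \<open>b\<close>, \<open>c\<close>; existence and uniqueness of barycentric coordinates reduce to
  it.\<close>

lemma cross2_nonzero:
  assumes "\<not> collinear {a, b, c}"
  shows "cross2 (b - a) (c - a) \<noteq> 0"
proof
  assume 0: "cross2 (b - a) (c - a) = 0"
  define p q where "p = b - a" and "q = c - a"
  have eq: "p $ 1 * q $ 2 = p $ 2 * q $ 1" using 0 by (simp add: cross2_def p_def q_def)
  have "p = 0 \<or> (\<exists>t. q = t *\<^sub>R p)"
  proof (cases "p $ 1 = 0")
    case True
    show ?thesis
    proof (cases "p $ 2 = 0")
      case False
      with True eq show ?thesis
        by (intro disjI2 exI[of _ "q $ 2 / p $ 2"]) (simp add: point_eq_iff)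
    qed (use True in \<open>simp add: point_eq_iff\<close>)
  next
    case False
    with eq show ?thesis
      by (intro disjI2 exI[of _ "q $ 1 / p $ 1"]) (simp add: point_eq_iff field_simps)
  qed
  then have "collinear {0, b - a, c - a}"
    unfolding p_def[symmetric] q_def[symmetric] by (auto simp: collinear_lemma)
  then have "collinear {b, a, c}"
    by (subst collinear_3) simp
  with assms show False by (simp add: insert_commute)
qed

text \<open>Cramer's rule for the gradient \<open>n\<close>.\<close>

lemma affine_interpolation:
  assumes "\<not> collinear {a, b, c :: point}"
  obtains m n where "m + n \<bullet> a = ya" "m + n \<bullet> b = yb" "m + n \<bullet> c = yc"
proof -
  define p q d where "p = b - a" and "q = c - a" and "d = cross2 p q"
  have d: "d \<noteq> 0" using cross2_nonzero[OF assms] by (simp add: d_def p_def q_def)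
  define n :: point where
    "n = vector [((yb - ya) * q $ 2 - (yc - ya) * p $ 2) / d, ((yc - ya) * p $ 1 - (yb - ya) * q $ 1) / d]"
  have n1: "n $ 1 * d = (yb - ya) * q $ 2 - (yc - ya) * p $ 2"
    and n2: "n $ 2 * d = (yc - ya) * p $ 1 - (yb - ya) * q $ 1"
    using d by (simp_all add: n_def vector_2)
  have "(n \<bullet> p) * d = n $ 1 * d * p $ 1 + n $ 2 * d * p $ 2"
    by (simp add: inner_point algebra_simps)
  also have "\<dots> = (yb - ya) * d"
    unfolding n1 n2 by (simp add: d_def cross2_def algebra_simps)
  finally have np: "n \<bullet> p = yb - ya" using d by simp
  have "(n \<bullet> q) * d = n $ 1 * d * q $ 1 + n $ 2 * d * q $ 2"
    by (simp add: inner_point algebra_simps)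
  also have "\<dots> = (yc - ya) * d"
    unfolding n1 n2 by (simp add: d_def cross2_def algebra_simps)
  finally have nq: "n \<bullet> q = yc - ya" using d by simp
  show ?thesis
    using np nq by (intro that[of "ya - n \<bullet> a" n]) (simp_all add: p_def q_def inner_diff_right)
qed

lemma affine_function_unique:
  fixes a b c :: point
  assumes "\<not> collinear {a, b, c}"
    and "m + n \<bullet> a = m' + n' \<bullet> a" "m + n \<bullet> b = m' + n' \<bullet> b" "m + n \<bullet> c = m' + n' \<bullet> c"
  shows "m = m' \<and> n = n'"
proof -
  define p q k where "p = b - a" and "q = c - a" and "k = n - n'"
  have d: "cross2 p q \<noteq> 0" using cross2_nonzero[OF assms(1)] by (simp add: p_def q_def)
  have "k \<bullet> p = 0" "k \<bullet> q = 0"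
    using assms(2-4) by (simp_all add: k_def p_def q_def algebra_simps)
  then have 1: "k $ 1 * p $ 1 + k $ 2 * p $ 2 = 0" and 2: "k $ 1 * q $ 1 + k $ 2 * q $ 2 = 0"
    by (simp_all add: inner_point)
  have "k $ 1 * cross2 p q = 0" "k $ 2 * cross2 p q = 0"
    using 1 2 unfolding cross2_def by algebra+
  with d have "k = 0" by (simp add: point_eq_iff)
  with assms(2) show ?thesis by (simp add: k_def)
qed

lemma vertices: "vertex E ` {1..3} = {vertex E 1, vertex E 2, vertex E 3}"
proof -
  have "{1..3::nat} = {1, 2, 3}" by auto
  then show ?thesis by auto
qed

lemma ball_1_3: "(\<forall>j\<in>{1..3::nat}. P j) \<longleftrightarrow> P 1 \<and> P 2 \<and> P 3"
proof -
  have "{1..3::nat} = {1, 2, 3}" by auto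
  then show ?thesis by simp
qed

lemma sum_1_3: "(\<Sum>j=1..3::nat. F j) = F 1 + F 2 + F 3"
proof -
  have "{1..3::nat} = {1, 2, 3}" by auto
  then show ?thesis by (simp add: add.assoc)
qed

text \<open>Vertices and barycentric coordinates depend on their index modulo 3 only, so that a
  statement about an arbitrary index reduces to the indices 1, 2, 3.\<close>

lemma mod_3_cases:
  obtains "j mod 3 = (1 :: nat) mod 3" | "j mod 3 = (2 :: nat) mod 3" | "j mod 3 = (3 :: nat) mod 3"
proof -
  have "j mod 3 = 0 \<or> j mod 3 = 1 \<or> j mod 3 = 2" by presburger
  then show ?thesis using that by auto
qed

lemma vertex_cong: "i mod 3 = j mod 3 \<Longrightarrow> vertex E i = vertex E j"
  by (cases E) simp

lemma barycentric_cong: "i mod 3 = j mod 3 \<Longrightarrow> barycentric E i = barycentric E j"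
  by (simp add: barycentric_def)

lemma barycentric_characterization:
  assumes "nondegenerate E"
  shows "(\<exists>a b. barycentric E i = (\<lambda>x. a + b \<bullet> x)) \<and>
    (\<forall>j\<in>{1..3}. barycentric E i (vertex E j) = (if j mod 3 = i mod 3 then 1 else 0))"
proof -
  have nc: "\<not> collinear {vertex E 1, vertex E 2, vertex E 3}"
    using assms unfolding nondegenerate_def vertices .
  let ?y = "\<lambda>j::nat. if j mod 3 = i mod 3 then 1 else 0 :: real"
  let ?P = "\<lambda>l. (\<exists>a b. l = (\<lambda>x :: point. a + b \<bullet> x)) \<and> (\<forall>j\<in>{1..3}. l (vertex E j) = ?y j)"
  obtain m n where "m + n \<bullet> vertex E 1 = ?y 1" "m + n \<bullet> vertex E 2 = ?y 2" "m + n \<bullet> vertex E 3 = ?y 3"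
    by (rule affine_interpolation[OF nc])
  then have "?P (\<lambda>x. m + n \<bullet> x)"
    unfolding ball_1_3 by blast
  moreover have "l = l'" if l: "?P l" and l': "?P l'" for l l'
  proof -
    obtain a b where 1: "l = (\<lambda>x. a + b \<bullet> x)" using l by blast
    obtain a' b' where 2: "l' = (\<lambda>x. a' + b' \<bullet> x)" using l' by blast
    have "a + b \<bullet> vertex E j = a' + b' \<bullet> vertex E j" if "j \<in> {1..3}" for j
      using l l' 1 2 that by metis
    then have "a = a' \<and> b = b'"
      by (intro affine_function_unique[OF nc]) simp_all
    with 1 2 show ?thesis by simp
  qed
  ultimately have "\<exists>!l. ?P l"
    by (intro ex_ex1I exI)
  then show ?thesis
    unfolding barycentric_def by (rule theI')
qed

lemma barycentric_vertex:
  assumes "nondegenerate E"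
  shows "barycentric E i (vertex E j) = (if j mod 3 = i mod 3 then 1 else 0)"
proof -
  have *: "\<forall>j\<in>{1..3}. barycentric E i (vertex E j) = (if j mod 3 = i mod 3 then 1 else 0)"
    using barycentric_characterization[OF assms] by blast
  show ?thesis
  proof (cases j rule: mod_3_cases)
    case 1
    from * have "barycentric E i (vertex E 1) = (if 1 mod 3 = i mod 3 then 1 else 0)"
      unfolding ball_1_3 by blast
    with 1 vertex_cong[OF 1] show ?thesis by metis
  next
    case 2
    from * have "barycentric E i (vertex E 2) = (if 2 mod 3 = i mod 3 then 1 else 0)"
      unfolding ball_1_3 by blast
    with 2 vertex_cong[OF 2] show ?thesis by metis
  next
    case 3
    from * have "barycentric E i (vertex E 3) = (if 3 mod 3 = i mod 3 then 1 else 0)"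
      unfolding ball_1_3 by blast
    with 3 vertex_cong[OF 3] show ?thesis by metis
  qed
qed

lemma barycentric_affine:
  assumes "nondegenerate E"
  obtains a b where "barycentric E i = (\<lambda>x. a + b \<bullet> x)"
  using barycentric_characterization[OF assms] by blast

lemma affine_on_combination:
  fixes a b c n :: point
  assumes "r + s + t = 1"
  shows "m + n \<bullet> (r *\<^sub>R a + s *\<^sub>R b + t *\<^sub>R c) = r * (m + n \<bullet> a) + s * (m + n \<bullet> b) + t * (m + n \<bullet> c)"
proof -
  have "m = (r + s + t) * m" using assms by simp
  then show ?thesis by (simp add: inner_add_right algebra_simps)
qed

lemma barycentric_combination:
  assumes E: "nondegenerate E" and "r + s + t = 1"
    and "x = r *\<^sub>R vertex E 1 + s *\<^sub>R vertex E 2 + t *\<^sub>R vertex E 3"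
  shows "barycentric E 1 x = r" "barycentric E 2 x = s" "barycentric E 3 x = t"
proof -
  have "barycentric E i x = r * barycentric E i (vertex E 1) + s * barycentric E i (vertex E 2)
       + t * barycentric E i (vertex E 3)" for i
  proof -
    obtain a b where "barycentric E i = (\<lambda>x. a + b \<bullet> x)" by (rule barycentric_affine[OF E])
    then show ?thesis by (simp add: assms(3) affine_on_combination[OF assms(2)])
  qed
  then show "barycentric E 1 x = r" "barycentric E 2 x = s" "barycentric E 3 x = t"
    by (simp_all add: barycentric_vertex[OF E])
qed

lemma continuous_barycentric:
  assumes "nondegenerate E"
  shows "continuous_on S (barycentric E i)"
proof -
  obtain a b where "barycentric E i = (\<lambda>x. a + b \<bullet> x)" by (rule barycentric_affine[OF assms])
  then show ?thesis by (simp add: continuous_on_add continuous_on_inner)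
qed

text \<open>Two affine functions that agree at the vertices are equal. Hence every affine function
  is the combination of the barycentric coordinates with its vertex values as coefficients; the
  constant 1 and the two Cartesian coordinates give the claims.\<close>

lemma barycentric_expansion:
  assumes E: "nondegenerate E"
  shows "x = barycentric E 1 x *\<^sub>R vertex E 1 + barycentric E 2 x *\<^sub>R vertex E 2 + barycentric E 3 x *\<^sub>R vertex E 3"
    and "barycentric E 1 x + barycentric E 2 x + barycentric E 3 x = 1"
proof -
  have nc: "\<not> collinear {vertex E 1, vertex E 2, vertex E 3}"
    using assms unfolding nondegenerate_def vertices .
  obtain a1 b1 a2 b2 a3 b3 where l: "barycentric E 1 = (\<lambda>x. a1 + b1 \<bullet> x)"
    "barycentric E 2 = (\<lambda>x. a2 + b2 \<bullet> x)" "barycentric E 3 = (\<lambda>x. a3 + b3 \<bullet> x)"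
    by (metis barycentric_affine[OF E])
  note v = barycentric_vertex[OF E]
  have agree: "m + n \<bullet> x = (a1 * y1 + a2 * y2 + a3 * y3) + (y1 *\<^sub>R b1 + y2 *\<^sub>R b2 + y3 *\<^sub>R b3) \<bullet> x"
    if "m + n \<bullet> vertex E 1 = y1" "m + n \<bullet> vertex E 2 = y2" "m + n \<bullet> vertex E 3 = y3"
    for m n y1 y2 y3
  proof -
    have "(a1 * y1 + a2 * y2 + a3 * y3) + (y1 *\<^sub>R b1 + y2 *\<^sub>R b2 + y3 *\<^sub>R b3) \<bullet> z
        = y1 * barycentric E 1 z + y2 * barycentric E 2 z + y3 * barycentric E 3 z" for z
      by (simp add: l algebra_simps)
    then have "m = (a1 * y1 + a2 * y2 + a3 * y3) \<and> n = (y1 *\<^sub>R b1 + y2 *\<^sub>R b2 + y3 *\<^sub>R b3)"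
      using that by (intro affine_function_unique[OF nc]) (simp_all add: v)
    then show ?thesis by simp
  qed
  have coord: "m + n \<bullet> x = (m + n \<bullet> vertex E 1) * barycentric E 1 x + (m + n \<bullet> vertex E 2) * barycentric E 2 x
      + (m + n \<bullet> vertex E 3) * barycentric E 3 x" for m n
    using agree[OF refl refl refl, of m n] by (simp add: l algebra_simps)
  show "barycentric E 1 x + barycentric E 2 x + barycentric E 3 x = 1"
    using coord[of 1 0] by simp
  have "x $ i = (barycentric E 1 x *\<^sub>R vertex E 1 + barycentric E 2 x *\<^sub>R vertex E 2 + barycentric E 3 x *\<^sub>R vertex E 3) $ i" for i
    using coord[of 0 "axis i 1"] by (simp add: inner_axis' mult.commute)
  then show "x = barycentric E 1 x *\<^sub>R vertex E 1 + barycentric E 2 x *\<^sub>R vertex E 2 + barycentric E 3 x *\<^sub>R vertex E 3"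
    by (simp add: vec_eq_iff)
qed

lemma region_iff:
  assumes E: "nondegenerate E"
  shows "x \<in> region E \<longleftrightarrow> 0 \<le> barycentric E 1 x \<and> 0 \<le> barycentric E 2 x \<and> 0 \<le> barycentric E 3 x"
proof
  assume "x \<in> region E"
  then obtain r s t where "0 \<le> r" "0 \<le> s" "0 \<le> t" "r + s + t = 1"
    "x = r *\<^sub>R vertex E 1 + s *\<^sub>R vertex E 2 + t *\<^sub>R vertex E 3"
    unfolding region_def vertices convex_hull_3 by blast
  then show "0 \<le> barycentric E 1 x \<and> 0 \<le> barycentric E 2 x \<and> 0 \<le> barycentric E 3 x"
    using barycentric_combination[OF E] by metis
next
  assume "0 \<le> barycentric E 1 x \<and> 0 \<le> barycentric E 2 x \<and> 0 \<le> barycentric E 3 x"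
  then show "x \<in> region E"
    unfolding region_def vertices convex_hull_3
    using barycentric_expansion[OF E, of x] by blast
qed

lemma barycentric_range:
  assumes E: "nondegenerate E" and x: "x \<in> region E"
  shows "0 \<le> barycentric E i x" "barycentric E i x \<le> 1"
proof -
  have "barycentric E i x \<in> {barycentric E 1 x, barycentric E 2 x, barycentric E 3 x}"
    by (cases i rule: mod_3_cases; drule barycentric_cong[where E = E]; simp)
  then show "0 \<le> barycentric E i x" "barycentric E i x \<le> 1"
    using x barycentric_expansion(2)[OF E, of x] unfolding region_iff[OF E] by auto
qed

lemma convex_region: "convex (region E)"
  by (simp add: region_def)

lemma compact_region: "compact (region E)"
  unfolding region_def by (intro finite_imp_compact_convex_hull) simp

lemma vertex_in_region: "vertex E j \<in> region E"
proof -
  have "vertex E j \<in> vertex E ` {1..3}"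
    unfolding vertices by (cases j rule: mod_3_cases; drule vertex_cong[where E = E]; simp)
  then show ?thesis unfolding region_def by (rule hull_inc)
qed

lemma edge_in_region: "t \<in> {0..1} \<Longrightarrow> linepath (vertex E i) (vertex E j) t \<in> region E"
  using convex_region[of E] vertex_in_region[of E]
  by (auto simp: linepath_def intro!: convexD)

text \<open>The set on which all barycentric coordinates are positive is open and contains the
  barycentre.\<close>

lemma interior_region_nonempty:
  assumes E: "nondegenerate E"
  shows "interior (region E) \<noteq> {}"
proof -
  let ?U = "{x. 0 < barycentric E 1 x} \<inter> {x. 0 < barycentric E 2 x} \<inter> {x. 0 < barycentric E 3 x}"
  define c where "c = (1/3) *\<^sub>R vertex E 1 + (1/3) *\<^sub>R vertex E 2 + (1/3) *\<^sub>R vertex E 3"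
  have "open {x. 0 < barycentric E i x}" for i
    by (intro open_Collect_less continuous_intros continuous_barycentric[OF E])
  then have "open ?U" by (intro open_Int)
  moreover have "?U \<subseteq> region E"
    by (auto simp: region_iff[OF E])
  moreover have "c \<in> ?U"
    using barycentric_combination[OF E _ c_def] by (simp only: mem_Collect_eq Int_iff) simp
  ultimately have "c \<in> interior (region E)"
    using interior_maximal[of ?U "region E"] by (rule_tac subsetD[of ?U])
  then show ?thesis by auto
qed

lemma dist_region_le_diameter:
  "x \<in> region E \<Longrightarrow> y \<in> region E \<Longrightarrow> dist x y \<le> diameter (region E)"
  by (intro diameter_bounded_bound compact_imp_bounded compact_region)


section \<open>Deviation of a function from its chords\<close>

text \<open>Along the segment, \<open>\<rho> / 2 (dist x y)\<^sup>2 t\<^sup>2\<close> minus the Taylor remainder at \<open>t\<close> has a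
  nonnegative derivative, by the Lipschitz condition on the gradient.\<close>

lemma taylor_upper_bound:
  fixes g :: "point \<Rightarrow> real"
  assumes U: "convex U" and d: "\<And>z. z \<in> U \<Longrightarrow> GDERIV g z :> D z" and L: "\<rho>-lipschitz_on U D"
    and x: "x \<in> U" and y: "y \<in> U"
  shows "g y - g x - D x \<bullet> (y - x) \<le> \<rho> / 2 * (dist x y)\<^sup>2"
proof -
  define z where "z t = x + t *\<^sub>R (y - x)" for t
  define k where "k t = \<rho> / 2 * (dist x y)\<^sup>2 * t\<^sup>2 - (g (z t) - t * (D x \<bullet> (y - x)))" for t
  have zU: "z t \<in> U" if "0 \<le> t" "t \<le> 1" for t
  proof -
    have "z t = (1 - t) *\<^sub>R x + t *\<^sub>R y" by (simp add: z_def algebra_simps)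
    then show ?thesis using convexD[OF U x y, of "1 - t" t] that by simp
  qed
  have "k 0 \<le> k 1"
  proof (rule DERIV_nonneg_imp_nondecreasing[where f = k and a = 0 and b = 1])
    fix t :: real assume t: "0 \<le> t" "t \<le> 1"
    have "(z has_derivative (\<lambda>s. s *\<^sub>R (y - x))) (at t)"
      unfolding z_def by (auto intro!: derivative_eq_intros)
    moreover have "(g has_derivative (\<lambda>h. h \<bullet> D (z t))) (at (z t))"
      using d[OF zU[OF t]] by (simp add: gderiv_def)
    ultimately have "((\<lambda>t. g (z t)) has_derivative (\<lambda>s. (s *\<^sub>R (y - x)) \<bullet> D (z t))) (at t)"
      by (rule has_derivative_compose)
    then have "((\<lambda>t. g (z t)) has_real_derivative (D (z t) \<bullet> (y - x))) (at t)"
      by (rule has_derivative_imp_has_field_derivative) (simp add: inner_commute)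
    then have "(k has_real_derivative
        (\<rho> * (dist x y)\<^sup>2 * t - (D (z t) \<bullet> (y - x) - D x \<bullet> (y - x)))) (at t)"
      unfolding k_def by (auto intro!: derivative_eq_intros)
    moreover have "(D (z t) - D x) \<bullet> (y - x) \<le> \<rho> * (dist x y)\<^sup>2 * t"
    proof -
      have "(D (z t) - D x) \<bullet> (y - x) \<le> norm (D (z t) - D x) * norm (y - x)"
        by (rule norm_cauchy_schwarz)
      also have "\<dots> \<le> (\<rho> * dist (z t) x) * norm (y - x)"
        using lipschitz_onD[OF L zU[OF t] x] by (intro mult_right_mono) (auto simp: dist_norm)
      also have "\<dots> = \<rho> * (dist x y)\<^sup>2 * t"
        using t by (simp add: z_def dist_norm norm_minus_commute power2_eq_square)
      finally show ?thesis .
    qed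
    ultimately show "\<exists>v. (k has_real_derivative v) (at t) \<and> 0 \<le> v"
      by (auto simp: inner_diff_left)
  qed simp
  then show ?thesis by (simp add: k_def z_def)
qed

lemma taylor_bound:
  fixes g :: "point \<Rightarrow> real"
  assumes U: "convex U" and d: "\<And>z. z \<in> U \<Longrightarrow> GDERIV g z :> D z" and L: "\<rho>-lipschitz_on U D"
    and x: "x \<in> U" and y: "y \<in> U"
  shows "\<bar>g y - g x - D x \<bullet> (y - x)\<bar> \<le> \<rho> / 2 * (dist x y)\<^sup>2"
proof -
  have "\<rho>-lipschitz_on U (\<lambda>z. - D z)" using L by simp
  from taylor_upper_bound[OF U GDERIV_minus[OF d] this x y] taylor_upper_bound[OF U d L x y]
  have "- (g y - g x - D x \<bullet> (y - x)) \<le> \<rho> / 2 * (dist x y)\<^sup>2" "g y - g x - D x \<bullet> (y - x) \<le> \<rho> / 2 * (dist x y)\<^sup>2"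
    by simp_all
  then show ?thesis unfolding abs_le_iff by simp
qed

text \<open>In Taylor's formula at the point \<open>x\<close> of the segment, taken at both ends, the gradient
  terms cancel in the convex combination that represents \<open>x\<close>. The two remainders add up to at most
  \<open>\<rho> / 2 t (1 - t) (dist a b)\<^sup>2\<close>.\<close>

lemma chord_error:
  fixes g :: "point \<Rightarrow> real"
  assumes U: "convex U" and d: "\<And>z. z \<in> U \<Longrightarrow> GDERIV g z :> D z" and L: "\<rho>-lipschitz_on U D"
    and a: "a \<in> U" and b: "b \<in> U" and t: "t \<in> {0..1}"
  shows "\<bar>g (linepath a b t) - ((1 - t) * g a + t * g b)\<bar> \<le> \<rho> / 8 * (dist a b)\<^sup>2"
proof -
  define x where "x = linepath a b t"
  define r where "r y = g y - g x - D x \<bullet> (y - x)" for y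
  have x: "x \<in> U" using convexD[OF U a b, of "1 - t" t] t by (simp add: x_def linepath_def)
  have \<rho>: "0 \<le> \<rho>" using L by (rule lipschitz_on_nonneg)
  have ax: "a - x = t *\<^sub>R (a - b)" and bx: "b - x = (1 - t) *\<^sub>R (b - a)"
    by (simp_all add: x_def linepath_def algebra_simps)
  have "(1 - t) * (D x \<bullet> (a - x)) + t * (D x \<bullet> (b - x)) = 0"
    unfolding ax bx by (simp add: algebra_simps)
  then have eq: "g x - ((1 - t) * g a + t * g b) = - ((1 - t) * r a + t * r b)"
    by (simp add: r_def algebra_simps)
  have "\<bar>(1 - t) * r a + t * r b\<bar> \<le> (1 - t) * \<bar>r a\<bar> + t * \<bar>r b\<bar>"
    using t by (intro order_trans[OF abs_triangle_ineq]) (simp add: abs_mult)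
  also have "\<dots> \<le> (1 - t) * (\<rho> / 2 * (t * dist a b)\<^sup>2) + t * (\<rho> / 2 * ((1 - t) * dist a b)\<^sup>2)"
  proof (intro add_mono mult_left_mono)
    have "dist x a = t * dist a b" "dist x b = (1 - t) * dist a b"
      using t arg_cong[OF ax, of norm] arg_cong[OF bx, of norm]
      by (simp_all add: dist_norm norm_minus_commute)
    then show "\<bar>r a\<bar> \<le> \<rho> / 2 * (t * dist a b)\<^sup>2" "\<bar>r b\<bar> \<le> \<rho> / 2 * ((1 - t) * dist a b)\<^sup>2"
      using taylor_bound[OF U d L x a] taylor_bound[OF U d L x b] by (simp_all add: r_def)
  qed (use t in auto)
  also have "\<dots> = \<rho> / 2 * (dist a b)\<^sup>2 * (t * (1 - t))"
    by (simp add: power2_eq_square) algebra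
  also have "\<dots> \<le> \<rho> / 2 * (dist a b)\<^sup>2 * (1 / 4)"
  proof (rule mult_left_mono)
    have "0 \<le> (t - 1 / 2)\<^sup>2" by simp
    then show "t * (1 - t) \<le> 1 / 4" by (simp add: power2_eq_square algebra_simps)
  qed (use \<rho> in simp)
  finally show ?thesis unfolding x_def[symmetric] eq abs_minus_cancel by simp
qed

text \<open>Edges of a triangle may lie on the boundary of the domain, where there is no gradient.
  The inequality carries over to them by continuity, as pairs of interior points are dense in the
  pairs of points of \<open>S\<close>.\<close>

lemma chord_error_closed:
  fixes G :: "point \<Rightarrow> real"
  assumes S: "convex S" "closed S" "interior S \<noteq> {}" and G: "continuous_on S G"
    and eq: "\<And>z. z \<in> interior S \<Longrightarrow> G z = g z"
    and d: "\<And>z. z \<in> interior S \<Longrightarrow> GDERIV g z :> D z" and L: "\<rho>-lipschitz_on (interior S) D"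
    and a: "a \<in> S" and b: "b \<in> S" and t: "t \<in> {0..1}"
  shows "\<bar>G (linepath a b t) - ((1 - t) * G a + t * G b)\<bar> \<le> \<rho> / 8 * (dist a b)\<^sup>2"
proof -
  define F where "F p = \<bar>G (linepath (fst p) (snd p) t) - ((1 - t) * G (fst p) + t * G (snd p))\<bar>
      - \<rho> / 8 * (dist (fst p) (snd p))\<^sup>2" for p
  have cl: "closure (interior S \<times> interior S) = S \<times> S"
    using convex_closure_interior[OF S(1,3)] S(2) by (simp add: closure_Times)
  have in_S: "linepath u v t \<in> S" if "u \<in> S" "v \<in> S" for u v
    using convexD[OF S(1) that, of "1 - t" t] t by (simp add: linepath_def)
  have "F (a, b) \<le> 0"
  proof (rule continuous_le_on_closure[where S = "interior S \<times> interior S"])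
    show "continuous_on (closure (interior S \<times> interior S)) F"
      unfolding cl F_def
    proof (intro continuous_intros)
      show "continuous_on (S \<times> S) (\<lambda>p. G (linepath (fst p) (snd p) t))"
        using in_S unfolding linepath_def
        by (intro continuous_on_compose2[OF G] continuous_intros) auto
      show "continuous_on (S \<times> S) (\<lambda>p. G (fst p))" "continuous_on (S \<times> S) (\<lambda>p. G (snd p))"
        by (intro continuous_on_compose2[OF G] continuous_intros; auto)+
    qed
    show "F p \<le> 0" if "p \<in> interior S \<times> interior S" for p
    proof -
      obtain u v where uv: "p = (u, v)" by (cases p)
      with that have p: "p = (u, v)" "u \<in> interior S" "v \<in> interior S" by auto
      have "linepath u v t \<in> interior S"
        using convexD[OF convex_interior[OF S(1)] p(2,3), of "1 - t" t] t by (simp add: linepath_def)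
      then show ?thesis
        using chord_error[OF convex_interior[OF S(1)] d L p(2,3) t] p
        by (simp add: F_def eq)
    qed
  qed (use a b cl in auto)
  then show ?thesis by (simp add: F_def)
qed


section \<open>Continuous extension to the closure of a Lipschitz domain\<close>

lemma GDERIV_grad:
  assumes "C11 \<Omega> g" "x \<in> \<Omega>"
  shows "GDERIV g x :> grad g x"
  unfolding grad_def
proof (rule theI')
  show "\<exists>!D. GDERIV g x :> D"
  proof (rule ex_ex1I)
    show "\<exists>D. GDERIV g x :> D" using assms by (simp add: C11_def)
    show "D = D'" if "GDERIV g x :> D" "GDERIV g x :> D'" for D D'
    proof -
      have "(\<lambda>h. h \<bullet> D) = (\<lambda>h. h \<bullet> D')"
        using that unfolding gderiv_def by (rule has_derivative_unique)
      then have "(D - D') \<bullet> D = (D - D') \<bullet> D'" by metis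
      then have "(D - D') \<bullet> (D - D') = 0" by (simp add: inner_diff_right)
      then show ?thesis by simp
    qed
  qed
qed

text \<open>The least Lipschitz constant is attained: it is the infimum of all of them, and the
  defining inequalities are closed conditions.\<close>

lemma lipschitz_const_lipschitz_on:
  assumes "\<exists>\<rho>. \<rho>-lipschitz_on S G"
  shows "(lipschitz_const S G)-lipschitz_on S G"
proof -
  define R where "R = {\<rho>. \<rho>-lipschitz_on S G}"
  have ne: "R \<noteq> {}" using assms by (simp add: R_def)
  have bdd: "bdd_below R" by (rule bdd_belowI[of _ 0]) (auto simp: R_def lipschitz_on_nonneg)
  have "(Inf R)-lipschitz_on S G"
  proof (rule lipschitz_onI)
    show "0 \<le> Inf R" by (rule cInf_greatest[OF ne]) (auto simp: R_def lipschitz_on_nonneg)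
    show "dist (G x) (G y) \<le> Inf R * dist x y" if xy: "x \<in> S" "y \<in> S" for x y
    proof (cases "x = y")
      case False
      have "dist (G x) (G y) / dist x y \<le> Inf R"
        using False xy by (intro cInf_greatest[OF ne]) (auto simp: R_def field_simps dest: lipschitz_onD)
      then show ?thesis using False by (simp add: field_simps)
    qed simp
  qed
  moreover have "lipschitz_const S G = Inf R"
    unfolding lipschitz_const_def
    by (rule Least_equality) (use calculation bdd in \<open>auto simp: R_def intro: cInf_lower\<close>)
  ultimately show ?thesis by simp
qed

lemma lipschitz_chart:
  assumes "lipschitz_domain \<Omega>" "p \<in> frontier \<Omega>"
  obtains r u w \<gamma> M where "r > 0" "norm u = 1" "norm w = 1" "u \<bullet> w = 0"
    "M-lipschitz_on UNIV \<gamma>" "\<Omega> \<inter> ball p r = {x \<in> ball p r. \<gamma> (x \<bullet> u) < x \<bullet> w}"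
proof -
  have "lipschitz_boundary \<Omega>" using assms(1) by (simp add: lipschitz_domain_def)
  from bspec[OF this[unfolded lipschitz_boundary_def] assms(2)] show ?thesis
    by (elim exE conjE) (rule that)
qed

text \<open>Below the graph that bounds the domain near a frontier point there is an open set that
  misses the domain, hence also its closure, and it comes arbitrarily close to that point.\<close>

lemma interior_closure_lipschitz_domain:
  assumes "lipschitz_domain \<Omega>"
  shows "interior (closure \<Omega>) = \<Omega>"
proof
  have op: "open \<Omega>" using assms by (auto simp: lipschitz_domain_def)
  show "\<Omega> \<subseteq> interior (closure \<Omega>)" using op closure_subset by (rule interior_maximal[rotated])
  show "interior (closure \<Omega>) \<subseteq> \<Omega>"
  proof (rule ccontr)
    assume "\<not> interior (closure \<Omega>) \<subseteq> \<Omega>"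
    then obtain p where p: "p \<in> interior (closure \<Omega>)" "p \<notin> \<Omega>" by blast
    then have "p \<in> frontier \<Omega>"
      using op interior_subset by (auto simp: frontier_def interior_open)
    then obtain r u w \<gamma> M where r: "r > 0" and "norm u = 1" and u: "norm w = 1" "u \<bullet> w = 0"
      and \<gamma>: "M-lipschitz_on UNIV \<gamma>" and \<Omega>: "\<Omega> \<inter> ball p r = {x \<in> ball p r. \<gamma> (x \<bullet> u) < x \<bullet> w}"
      by (rule lipschitz_chart[OF assms])
    define W where "W = ball p r \<inter> {x. x \<bullet> w < \<gamma> (x \<bullet> u)}"
    have "continuous_on UNIV \<gamma>" using \<gamma> by (rule lipschitz_on_continuous_on)
    then have "continuous_on UNIV (\<lambda>x. \<gamma> (x \<bullet> u))"
      by (rule continuous_on_compose2) (auto intro: continuous_intros)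
    then have "open W" unfolding W_def
      by (intro open_Int open_ball open_Collect_less) (auto intro: continuous_intros)
    moreover have "W \<inter> \<Omega> = {}"
    proof -
      have "x \<in> \<Omega> \<Longrightarrow> \<gamma> (x \<bullet> u) < x \<bullet> w" if "x \<in> ball p r" for x
        using \<Omega> that by blast
      then show ?thesis by (fastforce simp: W_def)
    qed
    ultimately have "W \<inter> closure \<Omega> = {}" using open_Int_closure_eq_empty by blast
    moreover obtain e where e: "e > 0" "ball p e \<subseteq> closure \<Omega>"
      using p(1) by (auto simp: mem_interior)
    (* a point below the graph, close to p *)
    define x where "x = p - (min e r / 2) *\<^sub>R w"
    have "x \<in> ball p e" "x \<in> ball p r"
      using e r u by (auto simp: x_def dist_norm)
    moreover have "x \<bullet> w < \<gamma> (x \<bullet> u)"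
    proof -
      have "p \<bullet> w \<le> \<gamma> (p \<bullet> u)" using \<Omega> p(2) r by (metis (mono_tags, lifting) IntD1 centre_in_ball mem_Collect_eq not_le)
      moreover have "w \<bullet> w = 1" "w \<bullet> u = 0" using u by (simp_all add: dot_square_norm inner_commute)
      ultimately show ?thesis using e r by (simp add: x_def inner_diff_left)
    qed
    ultimately have "x \<in> W" "x \<in> closure \<Omega>" using e(2) by (auto simp: W_def)
    with \<open>W \<inter> closure \<Omega> = {}\<close> show False by blast
  qed
qed

lemma bounded_grad:
  assumes "bounded \<Omega>" "C11 \<Omega> g"
  obtains B where "0 \<le> B" "\<And>x. x \<in> \<Omega> \<Longrightarrow> norm (grad g x) \<le> B"
proof -
  obtain \<rho> where "\<rho>-lipschitz_on \<Omega> (grad g)" using assms(2) by (auto simp: C11_def)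
  then have "bounded (grad g ` \<Omega>)"
    using bounded_uniformly_continuous_image[OF lipschitz_on_uniformly_continuous assms(1)] by blast
  then obtain B where "\<And>x. x \<in> \<Omega> \<Longrightarrow> norm (grad g x) \<le> B" by (auto simp: bounded_iff)
  then show ?thesis by (intro that[of "\<bar>B\<bar>"]) force+
qed

lemma increment_along_segment:
  fixes g :: "point \<Rightarrow> real"
  assumes "\<And>z. z \<in> closed_segment x y \<Longrightarrow> GDERIV g z :> D z"
    and "\<And>z. z \<in> closed_segment x y \<Longrightarrow> norm (D z) \<le> B"
  shows "\<bar>g x - g y\<bar> \<le> B * dist x y"
proof -
  have "norm (g x - g y) \<le> B * norm (x - y)"
  proof (rule differentiable_bound[where S = "closed_segment x y" and f' = "\<lambda>z h. h \<bullet> D z"])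
    show "(g has_derivative (\<lambda>h. h \<bullet> D z)) (at z within closed_segment x y)"
      if "z \<in> closed_segment x y" for z
      using assms(1)[OF that] by (simp add: gderiv_def has_derivative_at_withinI)
    show "onorm (\<lambda>h. h \<bullet> D z) \<le> B" if "z \<in> closed_segment x y" for z
    proof (rule onorm_le)
      show "norm (h \<bullet> D z) \<le> B * norm h" for h
        using Cauchy_Schwarz_ineq2[of h "D z"] mult_left_mono[OF assms(2)[OF that], of "norm h"]
        by (simp add: mult.commute)
    qed
  qed auto
  then show ?thesis by (simp add: dist_norm)
qed

text \<open>Although \<open>\<Omega>\<close> need not be convex, \<open>g\<close> is Lipschitz continuous near \<open>p\<close>: two nearby points are
  joined inside \<open>\<Omega>\<close> by a path of comparable length that goes up from \<open>x\<close>, across, and down to \<open>y\<close>.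
  Along each of its three straight pieces the increment of \<open>g\<close> is at most \<open>B\<close> times the length.\<close>

lemma limit_at_frontier:
  assumes \<Omega>: "lipschitz_domain \<Omega>" and g: "C11 \<Omega> g" and p: "p \<in> frontier \<Omega>"
  obtains l where "(g \<longlongrightarrow> l) (at p within \<Omega>)"
proof -
  have op: "open \<Omega>" and bd: "bounded \<Omega>"
    using \<Omega> by (auto simp: lipschitz_domain_def)
  obtain B where B: "0 \<le> B" "\<And>x. x \<in> \<Omega> \<Longrightarrow> norm (grad g x) \<le> B"
    by (rule bounded_grad[OF bd g]) auto
  obtain r u w \<gamma> M where r: "r > 0" and u: "norm u = 1" "norm w = 1" "u \<bullet> w = 0"
    and \<gamma>: "M-lipschitz_on UNIV \<gamma>" and eq: "\<Omega> \<inter> ball p r = {x \<in> ball p r. \<gamma> (x \<bullet> u) < x \<bullet> w}"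
    by (rule lipschitz_chart[OF \<Omega> p])
  have M: "0 \<le> M" using \<gamma> by (rule lipschitz_on_nonneg)
  have in_\<Omega>: "x \<in> \<Omega>" if "x \<in> ball p r" "\<gamma> (x \<bullet> u) < x \<bullet> w" for x using eq that by blast
  have above: "\<gamma> (x \<bullet> u) < x \<bullet> w" if "x \<in> ball p r" "x \<in> \<Omega>" for x using eq that by blast
  have ww: "w \<bullet> w = 1" "w \<bullet> u = 0" using u by (simp_all add: dot_square_norm inner_commute)
  (* Points at distance below \<eta> from p are less than 2 \<eta> apart, and lifting them by
     M * (2 * \<eta>) does not lead out of the chart. *)
  define \<eta> where "\<eta> = r / (1 + 2 * M)"
  have \<eta>: "\<eta> > 0" "\<eta> \<le> r" "\<eta> + M * (2 * \<eta>) = r"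
  proof -
    have "\<eta> * (1 + 2 * M) = r" using M by (simp add: \<eta>_def)
    then show eq: "\<eta> + M * (2 * \<eta>) = r" by (simp add: algebra_simps)
    show "\<eta> > 0" using r M by (simp add: \<eta>_def)
    then have "0 \<le> M * (2 * \<eta>)" using M by simp
    then show "\<eta> \<le> r" using eq by linarith
  qed
  define X where "X = \<Omega> \<inter> ball p \<eta>"
  have lip: "\<bar>g x - g y\<bar> \<le> B * (1 + 2 * M) * dist x y" if xy: "x \<in> X" "y \<in> X" for x y
  proof -
    (* Between x and y, \<gamma> rises by at most s above its values there. *)
    define d s where "d = dist x y" and "s = M * d"
    have xO: "x \<in> \<Omega>" "dist p x < \<eta>" and yO: "y \<in> \<Omega>" "dist p y < \<eta>" using xy by (auto simp: X_def)
    have d: "d < 2 * \<eta>" using dist_triangle[of x y p] xO yO by (simp add: d_def dist_commute)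
    have s: "0 \<le> s" "\<eta> + s \<le> r"
      using M mult_left_mono[of d "2 * \<eta>" M] d \<eta> by (auto simp: s_def d_def)
    have ball: "z + t *\<^sub>R w \<in> ball p r" if "dist p z < \<eta>" "0 \<le> t" "t \<le> s" for z t
    proof -
      have "dist p (z + t *\<^sub>R w) \<le> dist p z + norm (t *\<^sub>R w)"
        using norm_triangle_ineq4[of "p - z" "t *\<^sub>R w"] by (simp add: dist_norm algebra_simps)
      then show ?thesis using that s u by simp
    qed
    have up: "z + t *\<^sub>R w \<in> \<Omega>" if "z \<in> \<Omega>" "dist p z < \<eta>" "0 \<le> t" "t \<le> s" for z t
    proof (rule in_\<Omega>[OF ball[OF that(2-4)]])
      show "\<gamma> ((z + t *\<^sub>R w) \<bullet> u) < (z + t *\<^sub>R w) \<bullet> w"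
        using above[of z] that \<eta> by (simp add: inner_add_left ww)
    qed
    have vert: "\<bar>g z - g (z + s *\<^sub>R w)\<bar> \<le> B * s" if z: "z \<in> \<Omega>" "dist p z < \<eta>" for z
    proof -
      have "q \<in> \<Omega>" if q: "q \<in> closed_segment z (z + s *\<^sub>R w)" for q
      proof -
        obtain v where "0 \<le> v" "v \<le> 1" "q = (1 - v) *\<^sub>R z + v *\<^sub>R (z + s *\<^sub>R w)"
          using q by (auto simp: closed_segment_def)
        then have "q = z + (v * s) *\<^sub>R w" "0 \<le> v * s" "v * s \<le> s"
          using s mult_left_le_one_le[of s v] by (auto simp: algebra_simps)
        then show ?thesis using up[OF z] by blast
      qed
      then have "\<bar>g z - g (z + s *\<^sub>R w)\<bar> \<le> B * dist z (z + s *\<^sub>R w)"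
        by (intro increment_along_segment[where D = "grad g"] GDERIV_grad[OF g] B(2)) auto
      then show ?thesis using u s by (simp add: dist_norm)
    qed
    have "q \<in> \<Omega>" if q: "q \<in> closed_segment (x + s *\<^sub>R w) (y + s *\<^sub>R w)" for q
    proof -
      obtain v where v: "0 \<le> v" "v \<le> 1" "q = (1 - v) *\<^sub>R (x + s *\<^sub>R w) + v *\<^sub>R (y + s *\<^sub>R w)"
        using q by (auto simp: closed_segment_def)
      define z where "z = (1 - v) *\<^sub>R x + v *\<^sub>R y"
      have q: "q = z + s *\<^sub>R w" using v(3) by (simp add: z_def algebra_simps)
      have pz: "dist p z < \<eta>"
        using convexD[OF convex_ball[of p \<eta>], of x y "1 - v" v] xO yO v by (simp add: z_def)
      have \<gamma>_near: "\<gamma> (z \<bullet> u) \<le> \<gamma> (a \<bullet> u) + s" if "dist z a \<le> d" for a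
      proof -
        have "\<gamma> (z \<bullet> u) - \<gamma> (a \<bullet> u) \<le> M * \<bar>z \<bullet> u - a \<bullet> u\<bar>"
          using lipschitz_onD[OF \<gamma>, of "z \<bullet> u" "a \<bullet> u"] by (simp add: dist_real_def)
        also have "\<bar>z \<bullet> u - a \<bullet> u\<bar> \<le> dist z a"
          using Cauchy_Schwarz_ineq2[of "z - a" u] u by (simp add: dist_norm inner_diff_left)
        finally show ?thesis using that M
          by (smt (verit) mult_left_mono s_def)
      qed
      have zx: "z - x = v *\<^sub>R (y - x)" and zy: "z - y = (1 - v) *\<^sub>R (x - y)"
        by (simp_all add: z_def algebra_simps)
      have "dist z x \<le> d" "dist z y \<le> d"
        using v arg_cong[OF zx, of norm] arg_cong[OF zy, of norm]
        by (simp_all add: dist_norm d_def norm_minus_commute mult_left_le_one_le)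
      then have "\<gamma> (z \<bullet> u) < x \<bullet> w + s" "\<gamma> (z \<bullet> u) < y \<bullet> w + s"
        using \<gamma>_near above[of x] above[of y] xO yO \<eta> by fastforce+
      then have "\<gamma> (z \<bullet> u) - s < (1 - v) * (x \<bullet> w) + v * (y \<bullet> w)"
        using v(1,2) convex_bound_lt[of "- (x \<bullet> w)" "s - \<gamma> (z \<bullet> u)" "- (y \<bullet> w)" "1 - v" v] by simp
      then have "\<gamma> (q \<bullet> u) < q \<bullet> w"
        by (simp add: q inner_add_left ww) (simp add: z_def inner_add_left)
      then show "q \<in> \<Omega>" unfolding q by (rule in_\<Omega>[rotated]) (use ball pz s in auto)
    qed
    then have "\<bar>g (x + s *\<^sub>R w) - g (y + s *\<^sub>R w)\<bar> \<le> B * dist (x + s *\<^sub>R w) (y + s *\<^sub>R w)"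
      by (intro increment_along_segment[where D = "grad g"] GDERIV_grad[OF g] B(2)) auto
    then have "\<bar>g (x + s *\<^sub>R w) - g (y + s *\<^sub>R w)\<bar> \<le> B * d" by (simp add: d_def)
    then show ?thesis using vert[OF xO] vert[OF yO]
      unfolding d_def[symmetric] s_def by (simp add: algebra_simps)
  qed
  have "(B * (1 + 2 * M))-lipschitz_on X g"
    using B M lip by (intro lipschitz_onI) (auto simp: dist_real_def)
  then have "uniformly_continuous_on X g" by (rule lipschitz_on_uniformly_continuous)
  moreover have "p \<in> closure X"
    using p \<eta>(1) open_Int_closure_subset[of "ball p \<eta>" \<Omega>]
    by (auto simp: X_def frontier_def Int_commute)
  ultimately obtain l where "(g \<longlongrightarrow> l) (at p within X)"
    by (rule uniformly_continuous_on_extension_at_closure)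
  moreover have "at p within X = at p within \<Omega>"
    unfolding X_def using \<eta>(1) by (intro at_within_nhd[of p "ball p \<eta>"]) auto
  ultimately show ?thesis using that by simp
qed

text \<open>The values at the frontier are limits of \<open>g\<close> within \<open>\<Omega>\<close>, so that closeness of values
  can be tested at points of \<open>\<Omega>\<close>.\<close>

lemma closure_ext_continuous:
  assumes \<Omega>: "lipschitz_domain \<Omega>" and g: "C11 \<Omega> g"
  shows "continuous_on (closure \<Omega>) (closure_ext \<Omega> g)"
proof -
  let ?G = "closure_ext \<Omega> g"
  have op: "open \<Omega>" using \<Omega> by (auto simp: lipschitz_domain_def)
  have lim: "(g \<longlongrightarrow> ?G p) (at p within \<Omega>)" if p: "p \<in> closure \<Omega>" for p
  proof (cases "p \<in> \<Omega>")
    case True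
    have "isCont g p"
      using GDERIV_grad[OF g True] unfolding gderiv_def by (rule has_derivative_continuous)
    then show ?thesis using True by (simp add: closure_ext_def isCont_def Lim_at_imp_Lim_at_within)
  next
    case False
    then have "p \<in> frontier \<Omega>" using p op by (simp add: frontier_def interior_open)
    then obtain l where l: "(g \<longlongrightarrow> l) (at p within \<Omega>)" by (rule limit_at_frontier[OF \<Omega> g])
    have "at p within \<Omega> \<noteq> bot" using False p
      by (metis islimpt_in_closure trivial_limit_within Diff_empty Diff_insert0)
    then have "?G p = l" using False l by (simp add: closure_ext_def tendsto_Lim)
    then show ?thesis using l by simp
  qed
  have near: "\<exists>\<delta>>0. \<forall>x\<in>\<Omega>. dist x p < \<delta> \<longrightarrow> dist (g x) (?G p) < e"
    if p: "p \<in> closure \<Omega>" and e: "e > 0" for p e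
  proof -
    obtain \<delta> where "\<delta> > 0" and \<delta>: "\<And>x. x \<in> \<Omega> \<Longrightarrow> 0 < dist x p \<Longrightarrow> dist x p < \<delta> \<Longrightarrow> dist (g x) (?G p) < e"
      using lim[OF p] e unfolding Lim_within by metis
    moreover have "dist (g p) (?G p) < e" if "p \<in> \<Omega>" using that e by (simp add: closure_ext_def)
    ultimately show ?thesis by (metis zero_less_dist_iff)
  qed
  show ?thesis unfolding continuous_on_iff
  proof (intro ballI allI impI)
    fix p and e :: real assume p: "p \<in> closure \<Omega>" and e: "e > 0"
    obtain \<delta> where \<delta>: "\<delta> > 0" "\<And>x. x \<in> \<Omega> \<Longrightarrow> dist x p < \<delta> \<Longrightarrow> dist (g x) (?G p) < e / 2"
      using near[OF p, of "e / 2"] e by auto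
    have "dist (?G q) (?G p) < e" if q: "q \<in> closure \<Omega>" "dist q p < \<delta>" for q
    proof -
      obtain \<delta>' where \<delta>': "\<delta>' > 0" "\<And>x. x \<in> \<Omega> \<Longrightarrow> dist x q < \<delta>' \<Longrightarrow> dist (g x) (?G q) < e / 2"
        using near[OF q(1), of "e / 2"] e by auto
      obtain x where x: "x \<in> \<Omega>" "dist x q < min \<delta>' (\<delta> - dist q p)"
        using q \<delta>' unfolding closure_approachable by (meson min_less_iff_conj diff_gt_0_iff_gt)
      have "dist x p < \<delta>" using dist_triangle[of x p q] x by simp
      then have "dist (g x) (?G p) < e / 2" "dist (g x) (?G q) < e / 2"
        using \<delta>(2) \<delta>'(2) x by auto
      then show ?thesis using dist_triangle_half_r dist_commute by metis
    qed
    then show "\<exists>d>0. \<forall>x'\<in>closure \<Omega>. dist x' p < d \<longrightarrow> dist (?G x') (?G p) < e"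
      using \<delta>(1) by blast
  qed
qed

lemma interior_region_subset:
  assumes "lipschitz_domain \<Omega>" "region E \<subseteq> closure \<Omega>"
  shows "interior (region E) \<subseteq> \<Omega>"
  using interior_mono[OF assms(2)] interior_closure_lipschitz_domain[OF assms(1)] by simp

text \<open>The form in which the regularity of \<open>g\<close> enters the error estimates.\<close>

lemma chord_error_region:
  assumes \<Omega>: "lipschitz_domain \<Omega>" and g: "C11 \<Omega> g" and E: "nondegenerate E" and sub: "region E \<subseteq> closure \<Omega>"
    and a: "a \<in> region E" and b: "b \<in> region E" and t: "t \<in> {0..1}"
  shows "\<bar>closure_ext \<Omega> g (linepath a b t) - ((1 - t) * closure_ext \<Omega> g a + t * closure_ext \<Omega> g b)\<bar>
    \<le> lipschitz_const \<Omega> (grad g) / 8 * (diameter (region E))\<^sup>2"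
proof -
  let ?L = "lipschitz_const \<Omega> (grad g)"
  have int: "interior (region E) \<subseteq> \<Omega>" by (rule interior_region_subset[OF \<Omega> sub])
  have L: "?L-lipschitz_on \<Omega> (grad g)"
    using g by (intro lipschitz_const_lipschitz_on) (simp add: C11_def)
  have "\<bar>closure_ext \<Omega> g (linepath a b t) - ((1 - t) * closure_ext \<Omega> g a + t * closure_ext \<Omega> g b)\<bar>
      \<le> ?L / 8 * (dist a b)\<^sup>2"
  proof (rule chord_error_closed[where S = "region E" and g = g and D = "grad g"])
    show "closed (region E)" by (rule compact_imp_closed[OF compact_region])
    show "continuous_on (region E) (closure_ext \<Omega> g)"
      using closure_ext_continuous[OF \<Omega> g] sub by (rule continuous_on_subset)
    show "closure_ext \<Omega> g z = g z" if "z \<in> interior (region E)" for z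
      using that int by (auto simp: closure_ext_def)
    show "GDERIV g z :> grad g z" if "z \<in> interior (region E)" for z
      using that int by (intro GDERIV_grad[OF g]) auto
    show "?L-lipschitz_on (interior (region E)) (grad g)" using L int by (rule lipschitz_on_subset)
  qed (use a b t convex_region interior_region_nonempty[OF E] in auto)
  also have "\<dots> \<le> ?L / 8 * (diameter (region E))\<^sup>2"
    using dist_region_le_diameter[OF a b] lipschitz_on_nonneg[OF L]
    by (intro mult_left_mono power_mono) auto
  finally show ?thesis .
qed


section \<open>Degrees of freedom of the enriched element\<close>

lemma barycentric_linepath:
  assumes "nondegenerate E"
  shows "barycentric E i (linepath a b t) = (1 - t) * barycentric E i a + t * barycentric E i b"
proof -
  obtain m n where "barycentric E i = (\<lambda>x. m + n \<bullet> x)" by (rule barycentric_affine[OF assms])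
  then show ?thesis by (simp add: linepath_def inner_add_right algebra_simps)
qed

lemma edge_length_pos:
  assumes "nondegenerate E"
  shows "edge_length E j > 0"
proof -
  have "vertex E (j + 1) \<noteq> vertex E (j + 2)"
  proof
    assume eq: "vertex E (j + 1) = vertex E (j + 2)"
    have "barycentric E (j + 1) (vertex E (j + 1)) = 1" "barycentric E (j + 1) (vertex E (j + 2)) = 0"
    proof -
      have "(j + 2) mod 3 \<noteq> (j + 1) mod 3" by presburger
      then show "barycentric E (j + 1) (vertex E (j + 1)) = 1" "barycentric E (j + 1) (vertex E (j + 2)) = 0"
        by (simp_all add: barycentric_vertex[OF assms])
    qed
    then show False using eq by simp
  qed
  then show ?thesis by (simp add: edge_length_def)
qed

lemma edge_mean_eq:
  assumes "nondegenerate E"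
  shows "edge_mean E j v = (LINT t:{0..1}|lebesgue. v (linepath (vertex E (j + 1)) (vertex E (j + 2)) t))"
  using edge_length_pos[OF assms, of j] by (simp add: edge_mean_def edge_integral_def)

lemma
  shows integrable_affine: "set_integrable lebesgue {0..1} (\<lambda>t :: real. (1 - t) * a + t * b)"
    and integral_affine: "(LINT t:{0..1}|lebesgue. (1 - t) * a + t * b) = (a + b) / 2"
proof -
  show int: "set_integrable lebesgue {0..1} (\<lambda>t :: real. (1 - t) * a + t * b)"
    by (intro absolutely_integrable_continuous_real continuous_intros)
  have "((\<lambda>t :: real. (1 - t) * a + t * b) has_integral ((a + b) / 2)) {0..1}"
  proof -
    have "((\<lambda>t :: real. (1 - t) * a + t * b) has_integral
        ((\<lambda>t. (t - t\<^sup>2 / 2) * a + t\<^sup>2 / 2 * b) 1 - (\<lambda>t. (t - t\<^sup>2 / 2) * a + t\<^sup>2 / 2 * b) 0)) {0..1}"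
      by (intro fundamental_theorem_of_calculus)
         (auto intro!: derivative_eq_intros simp flip: has_real_derivative_iff_has_vector_derivative)
    then show ?thesis by (simp add: field_simps)
  qed
  then show "(LINT t:{0..1}|lebesgue. (1 - t) * a + t * b) = (a + b) / 2"
    by (simp add: set_lebesgue_integral_eq_integral[OF int] integral_unique)
qed

text \<open>The span of a finite family, written as the set of all combinations over the index set:
  in contrast to sums over the set of generators, this form does not presuppose that the three
  generators are distinct.\<close>

lemma enrichment_span_combination:
  assumes "q \<in> enrichment_span E e"
  obtains c where "q = on_set (region E) (\<lambda>x. \<Sum>k=1..3. c k * e k x)"
proof -
  define F where "F c = on_set (region E) (\<lambda>x. \<Sum>k=1..3. c k * e k x)" for c
  have "fun_space.span ((\<lambda>k. on_set (region E) (e k)) ` {1..3}) \<subseteq> range F"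
  proof (rule fun_space.span_minimal)
    show "(\<lambda>k. on_set (region E) (e k)) ` {1..3} \<subseteq> range F"
    proof clarify
      fix k :: nat assume "k \<in> {1..3}"
      then have "on_set (region E) (e k) = F (\<lambda>i. if i = k then 1 else 0)"
        unfolding F_def by (simp add: if_distrib[of "\<lambda>z. z * _"] cong: if_cong)
      then show "on_set (region E) (e k) \<in> range F" by simp
    qed
    show "fun_space.subspace (range F)"
    proof (rule fun_space.subspaceI)
      have "0 = F (\<lambda>_. 0)" by (simp add: F_def on_set_def fun_eq_iff)
      then show "0 \<in> range F" using rangeI[of F "\<lambda>_. 0"] by metis
      show "x + y \<in> range F" if "x \<in> range F" "y \<in> range F" for x y
      proof -
        obtain c d where "x = F c" "y = F d" using \<open>x \<in> range F\<close> \<open>y \<in> range F\<close> by blast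
        then have "x + y = F (\<lambda>k. c k + d k)"
          by (simp add: F_def on_set_def fun_eq_iff distrib_right sum.distrib)
        then show ?thesis by (simp only: rangeI)
      qed
      show "(\<lambda>z. r * x z) \<in> range F" if "x \<in> range F" for r x
      proof -
        obtain c where "x = F c" using \<open>x \<in> range F\<close> by blast
        then have "(\<lambda>z. r * x z) = F (\<lambda>k. r * c k)"
          by (simp add: F_def on_set_def fun_eq_iff sum_distrib_left mult.assoc)
        then show ?thesis by (simp only: rangeI)
      qed
    qed
  qed
  then have "q \<in> range F" using assms by (auto simp: enrichment_span_def)
  then show ?thesis using that unfolding F_def by blast
qed

text \<open>Functions \<open>e k\<close> that vanish at the vertices and on the edges other than edge \<open>k\<close> decouple
  the degrees of freedom. The affine part of \<open>v\<close> is the interpolant of the vertex values. Its mean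
  over an edge is the mean of the two end values, and the rest of the mean of \<open>v\<close> over edge \<open>k\<close> is
  due to \<open>e k\<close> alone.\<close>

lemma enriched_space_reproduction:
  assumes E: "nondegenerate E"
    and vert: "\<And>j k. k \<in> {1..3} \<Longrightarrow> e k (vertex E j) = 0"
    and off: "\<And>j k t. j \<in> {1..3} \<Longrightarrow> k \<in> {1..3} \<Longrightarrow> k \<noteq> j \<Longrightarrow> t \<in> {0..1} \<Longrightarrow>
      e k (linepath (vertex E (j + 1)) (vertex E (j + 2)) t) = 0"
    and int: "\<And>k. k \<in> {1..3} \<Longrightarrow> edge_integrable E k (e k)"
    and nz: "\<And>k. k \<in> {1..3} \<Longrightarrow> edge_mean E k (e k) \<noteq> 0"
    and v: "v \<in> enriched_space E e" and x: "x \<in> region E"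
  shows "v x = (\<Sum>i=1..3. v (vertex E i) * barycentric E i x) +
    (\<Sum>k=1..3. (edge_mean E k v - (v (vertex E (k + 1)) + v (vertex E (k + 2))) / 2) / edge_mean E k (e k) * e k x)"
proof -
  obtain p q where pq: "v = p + q" "p \<in> P1 E" "q \<in> enrichment_span E e"
    using v by (auto simp: enriched_space_def)
  obtain a b where p: "p = on_set (region E) (\<lambda>x. a + b \<bullet> x)" using pq(2) by (auto simp: P1_def)
  obtain c where q: "q = on_set (region E) (\<lambda>x. \<Sum>k=1..3. c k * e k x)"
    by (rule enrichment_span_combination[OF pq(3)])
  have v_eq: "v y = (a + b \<bullet> y) + (\<Sum>k=1..3. c k * e k y)" if "y \<in> region E" for y
    using that by (simp add: pq(1) p q on_set_def)
  have v_vertex: "v (vertex E j) = a + b \<bullet> vertex E j" for j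
    by (simp add: v_eq vertex_in_region vert)
  have affine: "a + b \<bullet> x = (\<Sum>i=1..3. v (vertex E i) * barycentric E i x)"
    using affine_on_combination[OF barycentric_expansion(2)[OF E, of x], of a b "vertex E 1" "vertex E 2" "vertex E 3"]
    by (simp only: barycentric_expansion(1)[OF E, of x, symmetric] sum_1_3 v_vertex) (simp add: mult.commute)
  have coeff: "edge_mean E k v = (v (vertex E (k + 1)) + v (vertex E (k + 2))) / 2 + c k * edge_mean E k (e k)"
    if k: "k \<in> {1..3}" for k
  proof -
    let ?l = "linepath (vertex E (k + 1)) (vertex E (k + 2))"
    have "v (?l t) = ((1 - t) * v (vertex E (k + 1)) + t * v (vertex E (k + 2))) + c k * e k (?l t)"
      if t: "t \<in> {0..1}" for t
    proof -
      have "(\<Sum>i=1..3. c i * e i (?l t)) = (\<Sum>i\<in>{k}. c i * e i (?l t))"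
        using k off[OF k _ _ t] by (intro sum.mono_neutral_right) auto
      then have "v (?l t) = (a + b \<bullet> ?l t) + c k * e k (?l t)"
        by (simp add: v_eq edge_in_region[OF t])
      then show ?thesis unfolding v_vertex linepath_def by (simp add: inner_add_right algebra_simps)
    qed
    then have "edge_mean E k v = (LINT t:{0..1}|lebesgue.
        ((1 - t) * v (vertex E (k + 1)) + t * v (vertex E (k + 2))) + c k * e k (?l t))"
      unfolding edge_mean_eq[OF E] by (intro set_lebesgue_integral_cong) auto
    also have "\<dots> = (v (vertex E (k + 1)) + v (vertex E (k + 2))) / 2 + c k * edge_mean E k (e k)"
      using int[OF k] integrable_affine
      by (subst set_integral_add) (simp_all add: edge_integrable_def integral_affine edge_mean_eq[OF E])
    finally show ?thesis .
  qed
  have "c k = (edge_mean E k v - (v (vertex E (k + 1)) + v (vertex E (k + 2))) / 2) / edge_mean E k (e k)"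
    if "k \<in> {1..3}" for k
    using coeff[OF that] nz[OF that] by simp
  then show ?thesis using v_eq[OF x] affine by simp
qed

text \<open>Reproduction applied to the six basis functions gives them explicitly: \<open>\<phi> (k + 3)\<close> is
  \<open>e k\<close> divided by its mean over edge \<open>k\<close>, and \<open>\<phi> i\<close> is the barycentric coordinate \<open>i\<close> minus half
  the sum of the two \<open>\<phi> (k + 3)\<close> with \<open>k \<noteq> i\<close>, since that coordinate has mean \<open>1 / 2\<close> over the two
  edges that meet at the vertex \<open>i\<close>.\<close>

lemma local_projector_formula:
  assumes E: "nondegenerate E"
    and vert: "\<And>j k. k \<in> {1..3} \<Longrightarrow> e k (vertex E j) = 0"
    and off: "\<And>j k t. j \<in> {1..3} \<Longrightarrow> k \<in> {1..3} \<Longrightarrow> k \<noteq> j \<Longrightarrow> t \<in> {0..1} \<Longrightarrow>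
      e k (linepath (vertex E (j + 1)) (vertex E (j + 2)) t) = 0"
    and int: "\<And>k. k \<in> {1..3} \<Longrightarrow> edge_integrable E k (e k)"
    and nz: "\<And>k. k \<in> {1..3} \<Longrightarrow> edge_mean E k (e k) \<noteq> 0"
    and adm: "admissible E e" and x: "x \<in> region E"
  shows "local_projector E e G x = (\<Sum>i=1..3. G (vertex E i) * barycentric E i x) +
    (\<Sum>k=1..3. (edge_mean E k G - (G (vertex E (k + 1)) + G (vertex E (k + 2))) / 2) / edge_mean E k (e k) * e k x)"
proof -
  define \<phi> where "\<phi> = enriched_basis E e"
  have "\<exists>\<phi>. dual_basis E e \<phi>" using adm by (simp add: admissible_def)
  then have dual: "dual_basis E e \<phi>" unfolding \<phi>_def enriched_basis_def by (rule someI_ex)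
  have repr: "\<phi> i x = (\<Sum>j=1..3. \<phi> i (vertex E j) * barycentric E j x) +
      (\<Sum>k=1..3. (edge_mean E k (\<phi> i) - (\<phi> i (vertex E (k + 1)) + \<phi> i (vertex E (k + 2))) / 2)
        / edge_mean E k (e k) * e k x)" if i: "i \<in> {1..6}" for i
  proof (rule enriched_space_reproduction[OF E vert off int nz _ x])
    have "\<phi> i \<in> fun_space.span (\<phi> ` {1..6})" using i by (intro fun_space.span_base) simp
    then show "\<phi> i \<in> enriched_space E e" using dual by (simp add: dual_basis_def)
  qed
  have dofs: "\<forall>i\<in>{1..3}. \<forall>r\<in>{1..3}.
        \<phi> i (vertex E r) = (if i = r then 1 else 0) \<and> edge_mean E r (\<phi> i) = 0 \<and>
        \<phi> (i + 3) (vertex E r) = 0 \<and> edge_mean E r (\<phi> (i + 3)) = (if i = r then 1 else 0)"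
    using dual by (simp add: dual_basis_def vertex_value_def)
  have v4: "vertex E 4 = vertex E 1" and v5: "vertex E 5 = vertex E 2"
    by (rule vertex_cong, simp)+
  note d = dofs[unfolded ball_1_3]
  have
    "\<phi> 1 x = barycentric E 1 x - (e 2 x / edge_mean E 2 (e 2) + e 3 x / edge_mean E 3 (e 3)) / 2"
    "\<phi> 2 x = barycentric E 2 x - (e 1 x / edge_mean E 1 (e 1) + e 3 x / edge_mean E 3 (e 3)) / 2"
    "\<phi> 3 x = barycentric E 3 x - (e 1 x / edge_mean E 1 (e 1) + e 2 x / edge_mean E 2 (e 2)) / 2"
    "\<phi> 4 x = e 1 x / edge_mean E 1 (e 1)" "\<phi> 5 x = e 2 x / edge_mean E 2 (e 2)" "\<phi> 6 x = e 3 x / edge_mean E 3 (e 3)"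
    using d repr[of 1] repr[of 2] repr[of 3] repr[of 4] repr[of 5] repr[of 6]
    by (simp_all add: sum_1_3 v4 v5 add_divide_distrib)
  then show ?thesis
    unfolding local_projector_def \<phi>_def[symmetric] sum_1_3 vertex_value_def
    by (simp add: v4 v5) (simp add: diff_divide_distrib add_divide_distrib algebra_simps)
qed

text \<open>On edge \<open>j\<close> the barycentric coordinate \<open>j\<close> is 0. If \<open>k \<noteq> j\<close>, it is the argument of one of
  the two factors of the \<open>k\<close>-th enrichment function, which then vanishes; if \<open>k = j\<close>, it leaves only
  one summand of the weight.\<close>

lemma enrichment_on_edge:
  assumes E: "nondegenerate E" and f0: "\<And>l. l \<in> {1..6} \<Longrightarrow> f l 0 = 0"
    and jk: "j \<in> {1..3}" "k \<in> {1..3}"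
  shows "enrichment \<mu> \<alpha> \<beta> f E k (linepath (vertex E (j + 1)) (vertex E (j + 2)) t) =
    (if k = j then (1 - t) powr \<alpha> * t powr \<beta> * f (2 * k - 1) (1 - t) * f (2 * k) t else 0)"
proof -
  have "j = 1 \<or> j = 2 \<or> j = 3" "k = 1 \<or> k = 2 \<or> k = 3" using jk by auto
  then show ?thesis
    by (elim disjE) (simp_all add: enrichment_def weight_def sum_1_3 barycentric_linepath[OF E]
        barycentric_vertex[OF E] f0)
qed

lemma enrichment_at_vertex:
  assumes E: "nondegenerate E" and f0: "\<And>l. l \<in> {1..6} \<Longrightarrow> f l 0 = 0" and k: "k \<in> {1..3}"
  shows "enrichment \<mu> \<alpha> \<beta> f E k (vertex E j) = 0"
proof -
  have "\<not> ((k + 1) mod 3 = j mod 3 \<and> (k + 2) mod 3 = j mod 3)" by presburger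
  moreover have "2 * k - 1 \<in> {1..6}" "2 * k \<in> {1..6}" using k by auto
  ultimately show ?thesis using f0[of "2 * k - 1"] f0[of "2 * k"]
    by (auto simp: enrichment_def barycentric_vertex[OF E])
qed

text \<open>The integral whose reciprocal enters \<open>H_const\<close>. It is the mean of the \<open>k\<close>-th enrichment
  function over edge \<open>k\<close>, by \<open>edge_mean_enrichment\<close>.\<close>

definition edge_moment :: "real \<Rightarrow> real \<Rightarrow> (nat \<Rightarrow> real \<Rightarrow> real) \<Rightarrow> nat \<Rightarrow> real" where
  "edge_moment \<alpha> \<beta> f k =
     (LINT t:{0..1}|lebesgue. t powr \<alpha> * (1 - t) powr \<beta> * f (2 * k - 1) t * f (2 * k) (1 - t))"

text \<open>The edge is parametrised from vertex \<open>k + 1\<close> to vertex \<open>k + 2\<close>, so that the integrals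
  differ by the substitution of \<open>1 - t\<close> for \<open>t\<close>.\<close>

lemma edge_mean_enrichment:
  assumes E: "nondegenerate E" and f0: "\<And>l. l \<in> {1..6} \<Longrightarrow> f l 0 = 0" and k: "k \<in> {1..3}"
  shows "edge_mean E k (enrichment \<mu> \<alpha> \<beta> f E k) = edge_moment \<alpha> \<beta> f k"
proof -
  have "edge_moment \<alpha> \<beta> f k = (\<integral>t. indicator {0..1} (1 + - 1 * t) *\<^sub>R
      ((1 + - 1 * t) powr \<alpha> * (1 - (1 + - 1 * t)) powr \<beta> * f (2 * k - 1) (1 + - 1 * t)
        * f (2 * k) (1 - (1 + - 1 * t))) \<partial>lebesgue)"
    unfolding edge_moment_def set_lebesgue_integral_def
    by (subst lebesgue_integral_real_affine[where c = "- 1" and t = 1]) simp_all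
  also have "\<dots> = (LINT t:{0..1}|lebesgue. (1 - t) powr \<alpha> * t powr \<beta> * f (2 * k - 1) (1 - t) * f (2 * k) t)"
    unfolding set_lebesgue_integral_def by (intro Bochner_Integration.integral_cong) (auto simp: indicator_def)
  also have "\<dots> = edge_mean E k (enrichment \<mu> \<alpha> \<beta> f E k)"
    unfolding edge_mean_eq[OF E]
    by (intro set_lebesgue_integral_cong allI impI) (simp_all only: enrichment_on_edge[where f = f, OF E f0 k k] if_True refl, simp)
  finally show ?thesis by (rule sym)
qed

lemma on_set_in_enriched_space:
  assumes "k \<in> {1..3}"
  shows "on_set (region E) (e k) \<in> enriched_space E e"
proof -
  have "on_set (region E) (\<lambda>x. 0 + 0 \<bullet> x) \<in> P1 E" unfolding P1_def by blast
  moreover have "on_set (region E) (e k) \<in> enrichment_span E e"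
    unfolding enrichment_span_def using assms by (intro fun_space.span_base) simp
  moreover have "on_set (region E) (e k) = on_set (region E) (\<lambda>x. 0 + 0 \<bullet> x) + on_set (region E) (e k)"
    by (simp add: on_set_def fun_eq_iff)
  ultimately show ?thesis unfolding enriched_space_def by blast
qed

lemma edge_integrable_enrichment:
  assumes "functionals_well_defined E e" "j \<in> {1..3}" "k \<in> {1..3}"
  shows "edge_integrable E j (e k)"
proof -
  have "edge_integrable E j (on_set (region E) (e k))"
    using assms on_set_in_enriched_space[OF assms(3)] by (simp add: functionals_well_defined_def)
  then show ?thesis unfolding edge_integrable_def
    by (rule set_integrable_cong[THEN iffD1, rotated -1]) (auto simp: on_set_def edge_in_region)
qed


section \<open>Errors of linear interpolation and of the trapezoidal rule\<close>

text \<open>The ray from vertex 1 through \<open>x\<close> meets the opposite edge in a point \<open>y\<close>. The linear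
  interpolant at \<open>x\<close> arises by replacing \<open>G x\<close> by the chord from vertex 1 to \<open>y\<close>, and then \<open>G y\<close> by
  the chord of the edge; each step costs at most \<open>c\<close>.\<close>

lemma linear_interpolation_error:
  assumes E: "nondegenerate E" and x: "x \<in> region E"
    and chord: "\<And>a b t. a \<in> region E \<Longrightarrow> b \<in> region E \<Longrightarrow> t \<in> {0..1} \<Longrightarrow>
      \<bar>G (linepath a b t) - ((1 - t) * G a + t * G b)\<bar> \<le> c"
  shows "\<bar>G x - (\<Sum>i=1..3. G (vertex E i) * barycentric E i x)\<bar> \<le> 2 * c"
proof -
  have "x \<in> convex hull (insert (vertex E 1) {vertex E 2, vertex E 3})"
    using x by (simp only: region_def vertices)
  then obtain y u where u: "0 \<le> u" "u \<le> 1" and y: "y \<in> closed_segment (vertex E 2) (vertex E 3)"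
    and xy: "x = (1 - u) *\<^sub>R vertex E 1 + u *\<^sub>R y"
    unfolding convex_hull_insert_alt segment_convex_hull by auto
  obtain s where s: "0 \<le> s" "s \<le> 1" "y = (1 - s) *\<^sub>R vertex E 2 + s *\<^sub>R vertex E 3"
    using y by (auto simp: closed_segment_def)
  have yl: "y = linepath (vertex E 2) (vertex E 3) s" using s(3) by (simp add: linepath_def)
  have xl: "x = linepath (vertex E 1) y u" using xy by (simp add: linepath_def)
  have "x = (1 - u) *\<^sub>R vertex E 1 + (u * (1 - s)) *\<^sub>R vertex E 2 + (u * s) *\<^sub>R vertex E 3"
    by (simp add: xy s(3) algebra_simps)
  from barycentric_combination[OF E _ this]
  have bary: "barycentric E 1 x = 1 - u" "barycentric E 2 x = u * (1 - s)" "barycentric E 3 x = u * s"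
    by (simp_all add: algebra_simps)
  have yE: "y \<in> region E" unfolding yl using s by (intro edge_in_region) auto
  have 1: "\<bar>G x - ((1 - u) * G (vertex E 1) + u * G y)\<bar> \<le> c"
    unfolding xl using u by (intro chord vertex_in_region yE) auto
  have 2: "\<bar>G y - ((1 - s) * G (vertex E 2) + s * G (vertex E 3))\<bar> \<le> c" (is "\<bar>?d\<bar> \<le> c")
    unfolding yl using s by (intro chord vertex_in_region) auto
  have "\<bar>u * ?d\<bar> \<le> c"
    using 2 u mult_left_le_one_le[of "\<bar>?d\<bar>" u] by (simp add: abs_mult)
  moreover have "G x - (\<Sum>i=1..3. G (vertex E i) * barycentric E i x) =
      (G x - ((1 - u) * G (vertex E 1) + u * G y)) + u * ?d"
    unfolding sum_1_3 bary by (simp add: algebra_simps)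
  ultimately show ?thesis using 1 by linarith
qed

text \<open>The trapezoidal rule is the exact mean of the chord.\<close>

lemma trapezoidal_error:
  assumes E: "nondegenerate E" and G: "continuous_on (region E) G"
    and chord: "\<And>a b t. a \<in> region E \<Longrightarrow> b \<in> region E \<Longrightarrow> t \<in> {0..1} \<Longrightarrow>
      \<bar>G (linepath a b t) - ((1 - t) * G a + t * G b)\<bar> \<le> c"
  shows "\<bar>edge_mean E k G - (G (vertex E (k + 1)) + G (vertex E (k + 2))) / 2\<bar> \<le> c"
proof -
  let ?a = "vertex E (k + 1)" and ?b = "vertex E (k + 2)"
  let ?r = "\<lambda>t. G (linepath ?a ?b t) - ((1 - t) * G ?a + t * G ?b)"
  have int: "set_integrable lebesgue {0..1} (\<lambda>t. G (linepath ?a ?b t))"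
    by (intro absolutely_integrable_continuous_real continuous_on_compose2[OF G])
       (auto intro!: continuous_intros edge_in_region simp: image_subset_iff)
  have "edge_mean E k G - (G ?a + G ?b) / 2 = (LINT t:{0..1}|lebesgue. ?r t)"
    by (simp only: edge_mean_eq[OF E] set_integral_diff(2)[OF int integrable_affine] integral_affine)
  also have "\<bar>\<dots>\<bar> \<le> (LINT t:{0..1::real}|lebesgue. c)"
  proof -
    have r: "set_integrable lebesgue {0..1} ?r" by (rule set_integral_diff(1)[OF int integrable_affine])
    have "\<bar>LINT t:{0..1}|lebesgue. ?r t\<bar> \<le> (LINT t:{0..1}|lebesgue. \<bar>?r t\<bar>)"
      using set_integral_norm_bound[OF r] by simp
    also have "\<dots> \<le> (LINT t:{0..1::real}|lebesgue. c)"
      using r by (intro set_integral_mono chord vertex_in_region set_integrable_abs)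
        (auto intro!: absolutely_integrable_continuous_real)
    finally show ?thesis .
  qed
  also have "\<dots> = c" by (simp add: set_lebesgue_integral_def)
  finally show ?thesis .
qed


section \<open>Null sets and measurability\<close>

lemma AE_lebesgue_iff:
  fixes P :: "'a::euclidean_space \<Rightarrow> bool"
  shows "(AE x in lebesgue. P x) \<longleftrightarrow> negligible {x. \<not> P x}"
proof
  assume "AE x in lebesgue. P x"
  then obtain N where "N \<in> null_sets lebesgue" "{x. \<not> P x} \<subseteq> N"
    by (auto simp: eventually_ae_filter)
  then show "negligible {x. \<not> P x}"
    by (metis negligible_iff_null_sets negligible_subset)
next
  assume "negligible {x. \<not> P x}"
  then show "AE x in lebesgue. P x"
    by (intro AE_I'[of "{x. \<not> P x}"]) (auto simp: negligible_iff_null_sets)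
qed

lemma borel_measurable_AE_eq:
  fixes f h :: "'a::euclidean_space \<Rightarrow> real"
  assumes f: "f \<in> borel_measurable lebesgue" and eq: "AE x in lebesgue. f x = h x"
  shows "h \<in> borel_measurable lebesgue"
proof -
  define N where "N = {x. f x \<noteq> h x}"
  have N: "N \<in> null_sets lebesgue"
    using eq unfolding AE_lebesgue_iff N_def negligible_iff_null_sets .
  have "f \<in> borel_measurable (lebesgue_on (- N))"
    using f lebesgue_measurable_diff_null[OF N] by blast
  moreover have "f x = h x" if "x \<in> - N" for x using that by (simp add: N_def)
  ultimately have "h \<in> borel_measurable (lebesgue_on (- N))"
    by (subst measurable_cong[of _ h f]) auto
  then show ?thesis using lebesgue_measurable_diff_null[OF N] by blast
qed

lemma AE_reflect:
  fixes P :: "real \<Rightarrow> bool"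
  assumes "AE t in lebesgue. P t"
  shows "AE t in lebesgue. P (1 - t)"
proof -
  have "negligible ((\<lambda>t. 1 - t) ` {t. \<not> P t})"
    using assms unfolding AE_lebesgue_iff
    by (intro negligible_differentiable_image_negligible derivative_intros) auto
  moreover have "{t. \<not> P (1 - t)} \<subseteq> (\<lambda>t. 1 - t) ` {t. \<not> P t}"
    by (force simp: image_iff intro: exI[of _ "1 - _"])
  ultimately show ?thesis unfolding AE_lebesgue_iff by (rule negligible_subset)
qed

lemma negligible_Times_UNIV:
  fixes N :: "real set"
  assumes "negligible N"
  shows "negligible (N \<times> (UNIV :: real set))"
proof -
  obtain N' where "N' \<in> null_sets lborel" "N \<subseteq> N'"
    using assms unfolding negligible_iff_null_sets null_sets_completion_iff2 by blast
  then have "N' \<times> (UNIV :: real set) \<in> null_sets (lborel \<Otimes>\<^sub>M lborel)"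
    by (intro lborel.times_in_null_sets1) auto
  then have "N' \<times> (UNIV :: real set) \<in> null_sets lebesgue"
    unfolding lborel_prod by (rule null_sets_completionI)
  moreover have "N \<times> UNIV \<subseteq> N' \<times> (UNIV :: real set)" using \<open>N \<subseteq> N'\<close> by blast
  ultimately show ?thesis
    unfolding negligible_iff_null_sets[symmetric] by (rule negligible_subset)
qed

text \<open>A triangle's barycentric coordinates \<open>i\<close> and \<open>i + 1\<close> form a coordinate system of the
  plane. The exceptional points are the image of a null set times a line under the affine inverse
  of this coordinate system.\<close>

lemma AE_barycentric:
  assumes E: "nondegenerate E" and P: "AE t in lebesgue. P t"
  shows "AE x in lebesgue. P (barycentric E i x)"
proof -
  define F where "F = (\<lambda>(s, t). s *\<^sub>R vertex E i + t *\<^sub>R vertex E (i + 1) + (1 - s - t) *\<^sub>R vertex E (i + 2))"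
  have expand: "x = F (barycentric E i x, barycentric E (i + 1) x)" for x
  proof -
    have sum: "barycentric E i x + barycentric E (i + 1) x + barycentric E (i + 2) x = 1
      \<and> x = barycentric E i x *\<^sub>R vertex E i + barycentric E (i + 1) x *\<^sub>R vertex E (i + 1)
        + barycentric E (i + 2) x *\<^sub>R vertex E (i + 2)"
    proof -
      note e = barycentric_expansion[OF E, of x]
      note c = barycentric_cong[where E = E] vertex_cong[where E = E]
      show ?thesis
      proof (cases i rule: mod_3_cases)
        case 1
        then have "(i + 1) mod 3 = 2 mod 3" "(i + 2) mod 3 = 3 mod 3" by presburger+
        from c[OF 1] c[OF this(1)] c[OF this(2)] show ?thesis using e by (simp add: algebra_simps)
      next
        case 2
        then have "(i + 1) mod 3 = 3 mod 3" "(i + 2) mod 3 = 1 mod 3" by presburger+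
        from c[OF 2] c[OF this(1)] c[OF this(2)] show ?thesis using e by (simp add: algebra_simps)
      next
        case 3
        then have "(i + 1) mod 3 = 1 mod 3" "(i + 2) mod 3 = 2 mod 3" by presburger+
        from c[OF 3] c[OF this(1)] c[OF this(2)] show ?thesis using e by (simp add: algebra_simps)
      qed
    qed
    then have "1 - barycentric E i x - barycentric E (i + 1) x = barycentric E (i + 2) x" by linarith
    then show ?thesis using sum unfolding F_def by simp
  qed
  have "negligible (F ` ({t. \<not> P t} \<times> UNIV))"
  proof (rule negligible_differentiable_image_negligible)
    show "negligible ({t. \<not> P t} \<times> (UNIV :: real set))"
      using P unfolding AE_lebesgue_iff by (rule negligible_Times_UNIV)
    have "F = (\<lambda>p. fst p *\<^sub>R vertex E i + snd p *\<^sub>R vertex E (i + 1) + (1 - fst p - snd p) *\<^sub>R vertex E (i + 2))"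
      by (simp add: F_def fun_eq_iff)
    then show "F differentiable_on {t. \<not> P t} \<times> UNIV"
      by (auto intro!: derivative_intros bounded_linear_imp_differentiable_on[OF bounded_linear_fst]
          bounded_linear_imp_differentiable_on[OF bounded_linear_snd])
  qed simp
  moreover have "{x. \<not> P (barycentric E i x)} \<subseteq> F ` ({t. \<not> P t} \<times> UNIV)"
    using expand by blast
  ultimately show ?thesis unfolding AE_lebesgue_iff by (rule negligible_subset)
qed

lemma borel_measurable_barycentric_comp:
  fixes f :: "real \<Rightarrow> real"
  assumes E: "nondegenerate E" and f: "set_integrable lebesgue {0..1} f"
  shows "(\<lambda>x. f (barycentric E i x)) \<in> borel_measurable (lebesgue_on (region E))"
proof -
  have meas: "(\<lambda>t. indicator {0..1} t *\<^sub>R f t) \<in> borel_measurable lebesgue"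
    using f unfolding set_integrable_def by (rule borel_measurable_integrable)
  (* Only Borel functions can be composed freely; f is one up to a null set. *)
  obtain h where h: "h \<in> borel_measurable lborel" and eq: "AE t in lborel. indicator {0..1} t *\<^sub>R f t = h t"
    using completion_ex_borel_measurable_real[OF meas] by blast
  have \<lambda>: "barycentric E i \<in> borel_measurable borel"
    using continuous_barycentric[OF E] by (rule borel_measurable_continuous_onI)
  have R: "region E \<in> sets lebesgue" using compact_region[of E] by (simp add: compact_imp_closed borel_closed)
  have "(\<lambda>x. h (barycentric E i x)) \<in> borel_measurable borel"
    using measurable_compose[OF \<lambda>, of h borel] h by simp
  then have "(\<lambda>x. h (barycentric E i x)) \<in> borel_measurable (lebesgue_on (region E))"
    by (intro measurable_restrict_space1 measurable_completion) simp
  then have "(\<lambda>x. if x \<in> region E then h (barycentric E i x) else 0) \<in> borel_measurable lebesgue"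
    using R by (rule borel_measurable_if_I)
  moreover have "AE x in lebesgue. (if x \<in> region E then h (barycentric E i x) else 0)
      = (if x \<in> region E then f (barycentric E i x) else 0)"
    using AE_barycentric[OF E AE_completion[OF eq], of i]
    by eventually_elim (use barycentric_range[OF E, of _ i] in \<open>auto simp: indicator_def split: if_splits\<close>)
  ultimately have "(\<lambda>x. if x \<in> region E then f (barycentric E i x) else 0) \<in> borel_measurable lebesgue"
    by (rule borel_measurable_AE_eq)
  then show ?thesis by (rule borel_measurable_if_D)
qed

lemma borel_measurable_enrichment:
  assumes E: "nondegenerate E" and f: "\<And>l. l \<in> {1..6} \<Longrightarrow> set_integrable lebesgue {0..1} (f l)"
    and k: "k \<in> {1..3}"
  shows "enrichment \<mu> \<alpha> \<beta> f E k \<in> borel_measurable (lebesgue_on (region E))"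
proof -
  have \<lambda>[measurable]: "barycentric E i \<in> borel_measurable borel" for i
    using continuous_barycentric[OF E] by (rule borel_measurable_continuous_onI)
  have "weight \<mu> \<alpha> \<beta> E \<in> borel_measurable borel" unfolding weight_def by measurable
  then have "weight \<mu> \<alpha> \<beta> E \<in> borel_measurable (lebesgue_on (region E))"
    by (intro measurable_restrict_space1 measurable_completion) simp
  moreover have "2 * k - 1 \<in> {1..6}" "2 * k \<in> {1..6}" using k by auto
  ultimately show ?thesis unfolding enrichment_def
    by (intro borel_measurable_times borel_measurable_barycentric_comp[OF E f])
qed


section \<open>Bounds for the edge moments and the enrichment functions\<close>

text \<open>The \<open>f l\<close> may be unbounded, so integrability of the product is not automatic. It is
  part of the well-definedness of the edge means on the enriched space.\<close>

lemma edge_moment_integrable: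
  assumes E: "nondegenerate E" and f0: "\<And>l. l \<in> {1..6} \<Longrightarrow> f l 0 = 0" and k: "k \<in> {1..3}"
    and wd: "functionals_well_defined E (enrichment \<mu> \<alpha> \<beta> f E)"
  shows "set_integrable lebesgue {0..1} (\<lambda>t. t powr \<alpha> * (1 - t) powr \<beta> * f (2 * k - 1) t * f (2 * k) (1 - t))"
proof -
  let ?h = "\<lambda>t. (1 - t) powr \<alpha> * t powr \<beta> * f (2 * k - 1) (1 - t) * f (2 * k) t"
  have "set_integrable lebesgue {0..1} ?h"
    using edge_integrable_enrichment[OF wd k k]
    by (simp only: edge_integrable_def enrichment_on_edge[where f = f, OF E f0 k k] if_True refl)
  then have "integrable lebesgue (\<lambda>t. indicator {0..1} (1 + - 1 * t) *\<^sub>R ?h (1 + - 1 * t))"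
    unfolding set_integrable_def by (rule lebesgue_integrable_real_affine) simp
  moreover have "(\<lambda>t. indicator {0..1} (1 + - 1 * t) *\<^sub>R ?h (1 + - 1 * t)) =
      (\<lambda>t. indicator {0..1} t *\<^sub>R (t powr \<alpha> * (1 - t) powr \<beta> * f (2 * k - 1) t * f (2 * k) (1 - t)))"
    by (auto simp: indicator_def fun_eq_iff)
  ultimately show ?thesis unfolding set_integrable_def by simp
qed

text \<open>An integrand of constant sign with vanishing integral is zero almost everywhere, whereas
  this one is nonzero almost everywhere in the unit interval.\<close>

lemma edge_moment_nonzero:
  assumes int: "set_integrable lebesgue {0..1} (\<lambda>t. t powr \<alpha> * (1 - t) powr \<beta> * f (2 * k - 1) t * f (2 * k) (1 - t))"
    and sign: "\<And>l. l \<in> {1..6} \<Longrightarrow> (\<forall>t\<in>{0..1}. 0 \<le> f l t) \<or> (\<forall>t\<in>{0..1}. f l t \<le> 0)"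
    and nz: "\<And>l. l \<in> {1..6} \<Longrightarrow> AE t in lebesgue_on {0..1}. f l t \<noteq> 0"
    and k: "k \<in> {1..3}"
  shows "edge_moment \<alpha> \<beta> f k \<noteq> 0"
proof
  assume 0: "edge_moment \<alpha> \<beta> f k = 0"
  define h where "h t = indicator {0..1} t *\<^sub>R (t powr \<alpha> * (1 - t) powr \<beta> * f (2 * k - 1) t * f (2 * k) (1 - t))" for t
  have k6: "2 * k - 1 \<in> {1..6}" "2 * k \<in> {1..6}" using k by auto
  have int_h: "integrable lebesgue h" using int unfolding set_integrable_def h_def .
  have h0: "integral\<^sup>L lebesgue h = 0" using 0 unfolding edge_moment_def set_lebesgue_integral_def h_def .
  have "(\<forall>t. 0 \<le> h t) \<or> (\<forall>t. 0 \<le> - h t)"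
  proof -
    let ?p = "\<lambda>t. f (2 * k - 1) t * f (2 * k) (1 - t)"
    have h: "h t = indicator {0..1} t * (t powr \<alpha> * (1 - t) powr \<beta>) * ?p t" for t by (simp add: h_def)
    have "(\<forall>t\<in>{0..1}. 0 \<le> ?p t) \<or> (\<forall>t\<in>{0..1}. ?p t \<le> 0)"
      using sign[OF k6(1)] sign[OF k6(2)]
      by (elim disjE) (auto intro: mult_nonneg_nonneg mult_nonpos_nonpos mult_nonneg_nonpos mult_nonpos_nonneg)
    then show ?thesis
    proof
      assume "\<forall>t\<in>{0..1}. 0 \<le> ?p t"
      then have "0 \<le> h t" for t unfolding h by (cases "t \<in> {0..1}") auto
      then show ?thesis by blast
    next
      assume "\<forall>t\<in>{0..1}. ?p t \<le> 0"
      then have "h t \<le> 0" for t unfolding h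
        by (cases "t \<in> {0..1}") (auto intro: mult_nonneg_nonpos)
      then show ?thesis by simp
    qed
  qed
  then have h_zero: "AE t in lebesgue. h t = 0"
  proof
    assume "\<forall>t. 0 \<le> h t"
    then show ?thesis using h0 integral_nonneg_eq_0_iff_AE[OF int_h] by simp
  next
    assume "\<forall>t. 0 \<le> - h t"
    then show ?thesis using h0 integral_nonneg_eq_0_iff_AE[of lebesgue "\<lambda>t. - h t"] int_h by simp
  qed
  have nz': "AE t in lebesgue. t \<in> {0..1} \<longrightarrow> f l t \<noteq> 0" if "l \<in> {1..6}" for l
    using nz[OF that] by (simp add: AE_restrict_space_iff)
  have "AE t in lebesgue. t \<notin> {0<..<1::real}"
    using h_zero nz'[OF k6(1)] AE_reflect[OF nz'[OF k6(2)]]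
    by eventually_elim (auto simp: h_def)
  then have "negligible {0<..<1::real}" by (simp only: AE_lebesgue_iff not_not Collect_mem_eq)
  then show False using open_not_negligible[of "{0<..<1::real}"] by simp
qed

lemma edge_moment_le:
  assumes int: "set_integrable lebesgue {0..1} (\<lambda>t. t powr \<alpha> * (1 - t) powr \<beta> * f (2 * k - 1) t * f (2 * k) (1 - t))"
    and K: "\<And>l. l \<in> {1..6} \<Longrightarrow> AE t in lebesgue. t \<in> {0..1} \<longrightarrow> \<bar>f l t\<bar> \<le> K"
    and par: "\<alpha> \<ge> 0" "\<beta> \<ge> 0" and k: "k \<in> {1..3}"
  shows "\<bar>edge_moment \<alpha> \<beta> f k\<bar> \<le> K\<^sup>2"
proof -
  let ?h = "\<lambda>t. t powr \<alpha> * (1 - t) powr \<beta> * f (2 * k - 1) t * f (2 * k) (1 - t)"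
  have k6: "2 * k - 1 \<in> {1..6}" "2 * k \<in> {1..6}" using k by auto
  have h: "\<bar>?h t\<bar> \<le> K\<^sup>2" if "t \<in> {0..1}" "\<bar>f (2 * k - 1) t\<bar> \<le> K" "\<bar>f (2 * k) (1 - t)\<bar> \<le> K" for t
  proof -
    have "\<bar>t powr \<alpha> * (1 - t) powr \<beta>\<bar> \<le> 1 * 1"
      unfolding abs_mult using that(1) par by (intro mult_mono) (auto intro: powr_le1)
    then have "\<bar>t powr \<alpha> * (1 - t) powr \<beta>\<bar> * \<bar>f (2 * k - 1) t\<bar> * \<bar>f (2 * k) (1 - t)\<bar> \<le> 1 * K * K"
      using that by (intro mult_mono) auto
    then show ?thesis by (simp add: abs_mult power2_eq_square)
  qed
  have "\<bar>edge_moment \<alpha> \<beta> f k\<bar> \<le> (LINT t:{0..1}|lebesgue. \<bar>?h t\<bar>)"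
    using set_integral_norm_bound[OF int] unfolding edge_moment_def by simp
  also have "\<dots> \<le> (LINT t:{0..1::real}|lebesgue. K\<^sup>2)"
    unfolding set_lebesgue_integral_def
  proof (rule integral_mono_AE)
    show "integrable lebesgue (\<lambda>t. indicator {0..1} t *\<^sub>R \<bar>?h t\<bar>)"
      using set_integrable_abs[OF int] unfolding set_integrable_def .
    show "integrable lebesgue (\<lambda>t. indicator {0..1::real} t *\<^sub>R K\<^sup>2)"
      by (auto intro!: disjI2 integrable_real_indicator)
    show "AE t in lebesgue. indicator {0..1} t *\<^sub>R \<bar>?h t\<bar> \<le> indicator {0..1} t *\<^sub>R K\<^sup>2"
      using K[OF k6(1)] AE_reflect[OF K[OF k6(2)]]
      by eventually_elim (use h in \<open>auto simp: indicator_def\<close>)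
  qed
  also have "\<dots> = K\<^sup>2" by (simp add: set_lebesgue_integral_def)
  finally show ?thesis .
qed

text \<open>With \<open>m\<close> the weighted arithmetic mean, add up the inequalities \<open>ln (z / m) \<le> z / m - 1\<close> for
  the three numbers \<open>z\<close>, with the respective weights.\<close>

lemma weighted_am_gm:
  fixes a b c :: real
  assumes "p \<ge> 0" "q \<ge> 0" "r \<ge> 0" "p + q + r = 1" "a \<ge> 0" "b \<ge> 0" "c \<ge> 0"
  shows "a powr p * b powr q * c powr r \<le> p * a + q * b + r * c"
proof (cases "a = 0 \<or> b = 0 \<or> c = 0")
  case True
  then have "a powr p * b powr q * c powr r = 0" by auto
  also have "0 \<le> p * a + q * b + r * c" using assms by simp
  finally show ?thesis .
next
  case False
  then have pos: "a > 0" "b > 0" "c > 0" using assms by auto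
  define m where "m = p * a + q * b + r * c"
  have "m > 0"
  proof -
    have "0 \<le> p * a" "0 \<le> q * b" "0 \<le> r * c" using assms by simp_all
    moreover have "\<not> (p * a = 0 \<and> q * b = 0 \<and> r * c = 0)" using pos assms(4) by auto
    ultimately show ?thesis unfolding m_def by linarith
  qed
  have ln_le: "w * ln z \<le> w * (ln m + (z / m - 1))" if "z > 0" "w \<ge> 0" for z w
    using ln_le_minus_one[of "z / m"] \<open>m > 0\<close> that by (intro mult_left_mono) (simp_all add: ln_div)
  have "p * ln a + q * ln b + r * ln c \<le>
      p * (ln m + (a / m - 1)) + q * (ln m + (b / m - 1)) + r * (ln m + (c / m - 1))"
    by (intro add_mono ln_le pos assms)
  also have "\<dots> = (p + q + r) * (ln m - 1) + (p * (a / m) + q * (b / m) + r * (c / m))"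
    by (simp add: algebra_simps)
  also have "p * (a / m) + q * (b / m) + r * (c / m) = m / m"
    unfolding m_def by (simp only: times_divide_eq_right add_divide_distrib)
  also have "(p + q + r) * (ln m - 1) + m / m = ln m" using \<open>m > 0\<close> assms(4) by simp
  finally have "exp (p * ln a + q * ln b + r * ln c) \<le> exp (ln m)" by simp
  then show ?thesis using pos \<open>m > 0\<close> by (simp add: powr_def exp_add m_def)
qed

text \<open>Each of the three summands is bounded by its weighted arithmetic mean. In the sum of these,
  \<open>\<mu>\<close> gets the factor 2 and \<open>\<alpha> + \<beta>\<close> the factor 1, as the coordinates add up to 1.\<close>

lemma weight_bounds:
  assumes E: "nondegenerate E" and x: "x \<in> region E"
    and par: "\<mu> > 0" "\<alpha> > 0" "\<beta> > 0" "\<mu> + \<alpha> + \<beta> = 1"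
  shows "0 \<le> weight \<mu> \<alpha> \<beta> E x" "weight \<mu> \<alpha> \<beta> E x \<le> \<mu> + 1"
proof -
  let ?l = "\<lambda>i. barycentric E i x"
  have l4: "?l 4 = ?l 1" and l5: "?l 5 = ?l 2"
    by (simp_all add: barycentric_cong[of 4 1 E] barycentric_cong[of 5 2 E])
  have sum: "?l 1 + ?l 2 + ?l 3 = 1" using barycentric_expansion(2)[OF E] .
  show "0 \<le> weight \<mu> \<alpha> \<beta> E x" by (simp add: weight_def sum_nonneg)
  have "weight \<mu> \<alpha> \<beta> E x \<le> (\<Sum>j=1..3. \<mu> * (1 - ?l j) + \<alpha> * ?l (j + 1) + \<beta> * ?l (j + 2))"
    unfolding weight_def using par barycentric_range[OF E x]
    by (intro sum_mono weighted_am_gm) (auto simp: algebra_simps)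
  also have "\<dots> = \<mu> * (3 - (?l 1 + ?l 2 + ?l 3)) + (\<alpha> + \<beta>) * (?l 1 + ?l 2 + ?l 3)"
    unfolding sum_1_3 by (simp add: l4 l5 algebra_simps)
  also have "\<dots> = \<mu> + 1" unfolding sum using par by simp
  finally show "weight \<mu> \<alpha> \<beta> E x \<le> \<mu> + 1" .
qed

lemma enrichment_bound:
  assumes E: "nondegenerate E" and par: "\<mu> > 0" "\<alpha> > 0" "\<beta> > 0" "\<mu> + \<alpha> + \<beta> = 1"
    and K: "\<And>l. l \<in> {1..6} \<Longrightarrow> AE t in lebesgue. t \<in> {0..1} \<longrightarrow> \<bar>f l t\<bar> \<le> K"
    and k: "k \<in> {1..3}"
  shows "AE x in lebesgue. x \<in> region E \<longrightarrow> \<bar>enrichment \<mu> \<alpha> \<beta> f E k x\<bar> \<le> (\<mu> + 1) * K\<^sup>2"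
proof -
  have k6: "2 * k - 1 \<in> {1..6}" "2 * k \<in> {1..6}" using k by auto
  show ?thesis
    using AE_barycentric[OF E K[OF k6(1)], of "k + 1"] AE_barycentric[OF E K[OF k6(2)], of "k + 2"]
  proof eventually_elim
    case (elim x)
    show ?case
    proof
      assume x: "x \<in> region E"
      then have "\<bar>f (2 * k - 1) (barycentric E (k + 1) x)\<bar> \<le> K" "\<bar>f (2 * k) (barycentric E (k + 2) x)\<bar> \<le> K"
        using elim barycentric_range[OF E x] by auto
      then have "\<bar>weight \<mu> \<alpha> \<beta> E x\<bar> * \<bar>f (2 * k - 1) (barycentric E (k + 1) x)\<bar>
          * \<bar>f (2 * k) (barycentric E (k + 2) x)\<bar> \<le> (\<mu> + 1) * K * K"
        using weight_bounds[OF E x par] par by (intro mult_mono) auto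
      then show "\<bar>enrichment \<mu> \<alpha> \<beta> f E k x\<bar> \<le> (\<mu> + 1) * K\<^sup>2"
        by (simp add: enrichment_def abs_mult power2_eq_square mult.assoc)
    qed
  qed
qed


section \<open>The error on one triangle\<close>

lemma local_projector_enrichment:
  assumes E: "nondegenerate E" and f0: "\<And>l. l \<in> {1..6} \<Longrightarrow> f l 0 = 0"
    and wd: "functionals_well_defined E (enrichment \<mu> \<alpha> \<beta> f E)"
    and adm: "admissible E (enrichment \<mu> \<alpha> \<beta> f E)"
    and nz: "\<And>k. k \<in> {1..3} \<Longrightarrow> edge_moment \<alpha> \<beta> f k \<noteq> 0"
    and x: "x \<in> region E"
  shows "local_projector E (enrichment \<mu> \<alpha> \<beta> f E) G x = (\<Sum>i=1..3. G (vertex E i) * barycentric E i x) +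
    (\<Sum>k=1..3. (edge_mean E k G - (G (vertex E (k + 1)) + G (vertex E (k + 2))) / 2)
      / edge_moment \<alpha> \<beta> f k * enrichment \<mu> \<alpha> \<beta> f E k x)"
proof -
  let ?e = "enrichment \<mu> \<alpha> \<beta> f E"
  have mean: "edge_mean E k (?e k) = edge_moment \<alpha> \<beta> f k" if "k \<in> {1..3}" for k
    using edge_mean_enrichment[where f = f, OF E f0 that] .
  have "local_projector E ?e G x = (\<Sum>i=1..3. G (vertex E i) * barycentric E i x) +
    (\<Sum>k=1..3. (edge_mean E k G - (G (vertex E (k + 1)) + G (vertex E (k + 2))) / 2)
      / edge_mean E k (?e k) * ?e k x)"
  proof (rule local_projector_formula[OF E _ _ _ _ adm x])
    show "?e k (vertex E j) = 0" if "k \<in> {1..3}" for j k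
      using enrichment_at_vertex[where f = f, OF E f0 that] .
    show "?e k (linepath (vertex E (j + 1)) (vertex E (j + 2)) t) = 0"
      if "j \<in> {1..3}" "k \<in> {1..3}" "k \<noteq> j" for j k t
      using enrichment_on_edge[where f = f, OF E f0 that(1,2)] that(3) by simp
    show "edge_integrable E k (?e k)" if "k \<in> {1..3}" for k
      using edge_integrable_enrichment[OF wd that that] .
    show "edge_mean E k (?e k) \<noteq> 0" if "k \<in> {1..3}" for k
      using nz[OF that] mean[OF that] by simp
  qed
  then show ?thesis using mean by simp
qed

text \<open>The right-hand side makes sense for unbounded enrichment functions as well. It is 0 for
  \<open>c = 0\<close>, which is what the case of an affine \<open>g\<close> requires.\<close>

lemma local_error:
  assumes E: "nondegenerate E" and f0: "\<And>l. l \<in> {1..6} \<Longrightarrow> f l 0 = 0"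
    and wd: "functionals_well_defined E (enrichment \<mu> \<alpha> \<beta> f E)"
    and adm: "admissible E (enrichment \<mu> \<alpha> \<beta> f E)"
    and nz: "\<And>k. k \<in> {1..3} \<Longrightarrow> edge_moment \<alpha> \<beta> f k \<noteq> 0"
    and G: "continuous_on (region E) G"
    and chord: "\<And>a b t. a \<in> region E \<Longrightarrow> b \<in> region E \<Longrightarrow> t \<in> {0..1} \<Longrightarrow>
      \<bar>G (linepath a b t) - ((1 - t) * G a + t * G b)\<bar> \<le> c"
    and x: "x \<in> region E"
  shows "\<bar>G x - local_projector E (enrichment \<mu> \<alpha> \<beta> f E) G x\<bar>
    \<le> 2 * c + (\<Sum>k=1..3. c / \<bar>edge_moment \<alpha> \<beta> f k\<bar> * \<bar>enrichment \<mu> \<alpha> \<beta> f E k x\<bar>)"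
proof -
  let ?d = "\<lambda>k. edge_mean E k G - (G (vertex E (k + 1)) + G (vertex E (k + 2))) / 2"
  let ?I = "\<Sum>i=1..3. G (vertex E i) * barycentric E i x"
  let ?S = "\<Sum>k=1..3. ?d k / edge_moment \<alpha> \<beta> f k * enrichment \<mu> \<alpha> \<beta> f E k x"
  have proj: "local_projector E (enrichment \<mu> \<alpha> \<beta> f E) G x = ?I + ?S"
    by (rule local_projector_enrichment[where f = f, OF E f0 wd adm nz x])
  have "\<bar>?S\<bar> \<le> (\<Sum>k=1..3. \<bar>?d k / edge_moment \<alpha> \<beta> f k * enrichment \<mu> \<alpha> \<beta> f E k x\<bar>)" by (rule sum_abs)
  also have "\<dots> \<le> (\<Sum>k=1..3. c / \<bar>edge_moment \<alpha> \<beta> f k\<bar> * \<bar>enrichment \<mu> \<alpha> \<beta> f E k x\<bar>)"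
    unfolding abs_mult abs_divide
    by (intro sum_mono mult_right_mono divide_right_mono trapezoidal_error[OF E G chord]) auto
  finally have "\<bar>?S\<bar> \<le> (\<Sum>k=1..3. c / \<bar>edge_moment \<alpha> \<beta> f k\<bar> * \<bar>enrichment \<mu> \<alpha> \<beta> f E k x\<bar>)" .
  moreover have "\<bar>G x - ?I\<bar> \<le> 2 * c" by (rule linear_interpolation_error[OF E x chord])
  ultimately show ?thesis unfolding proj by linarith
qed

lemma borel_measurable_local_projector:
  assumes E: "nondegenerate E" and f: "\<And>l. l \<in> {1..6} \<Longrightarrow> set_integrable lebesgue {0..1} (f l)"
    and f0: "\<And>l. l \<in> {1..6} \<Longrightarrow> f l 0 = 0"
    and wd: "functionals_well_defined E (enrichment \<mu> \<alpha> \<beta> f E)"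
    and adm: "admissible E (enrichment \<mu> \<alpha> \<beta> f E)"
    and nz: "\<And>k. k \<in> {1..3} \<Longrightarrow> edge_moment \<alpha> \<beta> f k \<noteq> 0"
  shows "local_projector E (enrichment \<mu> \<alpha> \<beta> f E) G \<in> borel_measurable (lebesgue_on (region E))"
proof -
  let ?M = "lebesgue_on (region E)"
  have [measurable]: "barycentric E i \<in> borel_measurable ?M" for i
    using borel_measurable_continuous_onI[OF continuous_barycentric[OF E]]
    by (intro measurable_restrict_space1 measurable_completion) simp
  have "(\<lambda>x. (\<Sum>i=1..3. G (vertex E i) * barycentric E i x) +
    (\<Sum>k=1..3. (edge_mean E k G - (G (vertex E (k + 1)) + G (vertex E (k + 2))) / 2)
      / edge_moment \<alpha> \<beta> f k * enrichment \<mu> \<alpha> \<beta> f E k x)) \<in> borel_measurable ?M"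
    by (intro borel_measurable_add borel_measurable_sum borel_measurable_times borel_measurable_const
        borel_measurable_enrichment[OF E f]) auto
  moreover have "local_projector E (enrichment \<mu> \<alpha> \<beta> f E) G x = (\<Sum>i=1..3. G (vertex E i) * barycentric E i x) +
    (\<Sum>k=1..3. (edge_mean E k G - (G (vertex E (k + 1)) + G (vertex E (k + 2))) / 2)
      / edge_moment \<alpha> \<beta> f k * enrichment \<mu> \<alpha> \<beta> f E k x)" if "x \<in> region E" for x
    by (rule local_projector_enrichment[where f = f, OF E f0 wd adm nz that])
  ultimately show ?thesis by (subst measurable_cong) (simp_all only: space_lebesgue_on)
qed


section \<open>The error on the domain\<close>

lemma L2_norm_le:
  assumes \<Omega>: "\<Omega> \<in> lmeasurable" and u: "set_borel_measurable lebesgue \<Omega> u"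
    and bound: "AE x in lebesgue. x \<in> \<Omega> \<longrightarrow> \<bar>u x\<bar> \<le> B" and B: "0 \<le> B"
  shows "L2_norm \<Omega> u \<le> ennreal (B * sqrt (measure lebesgue \<Omega>))"
proof -
  have const: "set_integrable lebesgue \<Omega> (\<lambda>_. B\<^sup>2)"
    using \<Omega> by (auto simp: set_integrable_def fmeasurable_def intro!: disjI2 integrable_real_indicator)
  have sq: "AE x in lebesgue. x \<in> \<Omega> \<longrightarrow> (u x)\<^sup>2 \<le> B\<^sup>2"
    using bound by eventually_elim (use B in \<open>auto simp: abs_le_square_iff[symmetric]\<close>)
  have "(\<lambda>x. (indicator \<Omega> x *\<^sub>R u x)\<^sup>2) \<in> borel_measurable lebesgue"
    using u unfolding set_borel_measurable_def by measurable
  also have "(\<lambda>x. (indicator \<Omega> x *\<^sub>R u x)\<^sup>2) = (\<lambda>x. indicator \<Omega> x *\<^sub>R (u x)\<^sup>2)"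
    by (auto simp: indicator_def fun_eq_iff)
  finally have "set_borel_measurable lebesgue \<Omega> (\<lambda>x. (u x)\<^sup>2)" by (simp add: set_borel_measurable_def)
  then have int: "set_integrable lebesgue \<Omega> (\<lambda>x. (u x)\<^sup>2)"
    by (rule set_integrable_bound[OF const]) (use sq in auto)
  have "(LINT x:\<Omega>|lebesgue. (u x)\<^sup>2) \<le> (LINT x:\<Omega>|lebesgue. B\<^sup>2)"
    using int const unfolding set_integrable_def set_lebesgue_integral_def
  proof (rule integral_mono_AE)
    show "AE x in lebesgue. indicator \<Omega> x *\<^sub>R (u x)\<^sup>2 \<le> indicator \<Omega> x *\<^sub>R B\<^sup>2"
      using sq by eventually_elim (auto simp: indicator_def)
  qed
  also have "\<dots> = B\<^sup>2 * measure lebesgue \<Omega>"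
    by (simp add: set_lebesgue_integral_def)
  finally have "sqrt (LINT x:\<Omega>|lebesgue. (u x)\<^sup>2) \<le> sqrt (B\<^sup>2 * measure lebesgue \<Omega>)" by simp
  also have "\<dots> = B * sqrt (measure lebesgue \<Omega>)" using B by (simp add: real_sqrt_mult)
  finally show ?thesis using int u by (simp add: L2_norm_def ennreal_leI)
qed

text \<open>Almost every point of \<open>\<Omega>\<close> lies in the interior of exactly one triangle, because the
  boundary of a convex set is a null set. Up to a null set, the error is thus a finite sum of
  measurable functions with disjoint supports.\<close>

lemma L2_error_le:
  assumes \<Omega>: "lipschitz_domain \<Omega>" and T: "regular_mesh \<Omega> T" and g: "C11 \<Omega> g"
    and P: "is_global_projection T e (closure_ext \<Omega> g) \<Pi>g"
    and meas: "\<And>E. E \<in> T \<Longrightarrow> local_projector E (e E) (closure_ext \<Omega> g) \<in> borel_measurable (lebesgue_on (region E))"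
    and bound: "\<And>E. E \<in> T \<Longrightarrow> AE x in lebesgue. x \<in> region E \<longrightarrow>
      \<bar>closure_ext \<Omega> g x - local_projector E (e E) (closure_ext \<Omega> g) x\<bar> \<le> B"
    and B: "0 \<le> B"
  shows "L2_norm \<Omega> (\<lambda>x. g x - \<Pi>g x) \<le> ennreal (B * sqrt (measure lebesgue \<Omega>))"
proof -
  let ?G = "closure_ext \<Omega> g"
  have fin: "finite T" and cover: "(\<Union>E\<in>T. region E) = closure \<Omega>"
    and disj: "\<And>E E'. E \<in> T \<Longrightarrow> E' \<in> T \<Longrightarrow> E \<noteq> E' \<Longrightarrow> interior (region E) \<inter> interior (region E') = {}"
    using T by (auto simp: regular_mesh_def)
  have op: "open \<Omega>" "bounded \<Omega>" using \<Omega> by (auto simp: lipschitz_domain_def)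
  have int: "interior (region E) \<subseteq> \<Omega>" if "E \<in> T" for E
    using cover that by (intro interior_region_subset[OF \<Omega>]) auto
  have R: "region E \<in> sets lebesgue" for E
    using compact_region[of E] by (simp add: compact_imp_closed borel_closed)
  have cont: "continuous_on \<Omega> g"
    using GDERIV_grad[OF g] unfolding gderiv_def
    by (intro differentiable_imp_continuous_on) (auto simp: differentiable_on_def differentiable_def intro: has_derivative_at_withinI)
  define w where "w E x = (if x \<in> interior (region E) then g x - local_projector E (e E) ?G x else 0)" for E x
  have w_meas: "w E \<in> borel_measurable lebesgue" if E: "E \<in> T" for E
  proof -
    have I: "interior (region E) \<in> sets lebesgue" by simp
    have "g \<in> borel_measurable (lebesgue_on (interior (region E)))"
      using continuous_on_subset[OF cont int[OF E]] by (rule continuous_imp_measurable_on_sets_lebesgue) simp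
    moreover have "local_projector E (e E) ?G \<in> borel_measurable (lebesgue_on (interior (region E)))"
      using meas[OF E] interior_subset by (rule measurable_restrict_mono)
    ultimately show ?thesis
      unfolding w_def by (intro borel_measurable_if_I borel_measurable_diff I)
  qed
  have "AE x in lebesgue. x \<notin> frontier (region E)" for E
    by (simp add: AE_lebesgue_iff negligible_convex_frontier convex_region)
  then have frontiers: "AE x in lebesgue. \<forall>E\<in>T. x \<notin> frontier (region E)"
    using fin by (simp add: AE_ball_countable countable_finite)
  have "AE x in lebesgue. x \<in> region E \<longrightarrow> \<Pi>g x = local_projector E (e E) ?G x" if "E \<in> T" for E
    using P that by (simp add: is_global_projection_def AE_restrict_space_iff R)
  then have proj: "AE x in lebesgue. \<forall>E\<in>T. x \<in> region E \<longrightarrow> \<Pi>g x = local_projector E (e E) ?G x"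
    using fin by (simp add: AE_ball_countable countable_finite)
  have "AE x in lebesgue. \<forall>E\<in>T. x \<in> region E \<longrightarrow> \<bar>?G x - local_projector E (e E) ?G x\<bar> \<le> B"
    using bound fin by (simp add: AE_ball_countable countable_finite)
  from frontiers proj this
  have main: "AE x in lebesgue. (\<Sum>E\<in>T. w E x) = indicator \<Omega> x *\<^sub>R (g x - \<Pi>g x) \<and> (x \<in> \<Omega> \<longrightarrow> \<bar>g x - \<Pi>g x\<bar> \<le> B)"
  proof eventually_elim
    case (elim x)
    show ?case
    proof (cases "x \<in> \<Omega>")
      case True
      then obtain E where E: "E \<in> T" "x \<in> region E" using cover closure_subset by blast
      then have xi: "x \<in> interior (region E)"
        using elim(1) closure_subset by (fastforce simp: frontier_def)
      have "w E' x = 0" if "E' \<in> T - {E}" for E'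
        using disj[of E E'] that E xi by (auto simp: w_def)
      then have "(\<Sum>E\<in>T. w E x) = w E x"
        using fin E(1) by (simp add: sum.remove)
      then show ?thesis using True E elim xi by (simp add: w_def closure_ext_def)
    next
      case False
      then have "w E x = 0" if "E \<in> T" for E using int[OF that] by (auto simp: w_def)
      then show ?thesis using False by simp
    qed
  qed
  show ?thesis
  proof (rule L2_norm_le)
    show "\<Omega> \<in> lmeasurable" using op by (simp add: lmeasurable_open)
    have "(\<lambda>x. \<Sum>E\<in>T. w E x) \<in> borel_measurable lebesgue" using w_meas by (rule borel_measurable_sum)
    then show "set_borel_measurable lebesgue \<Omega> (\<lambda>x. g x - \<Pi>g x)"
      unfolding set_borel_measurable_def by (rule borel_measurable_AE_eq) (use main in eventually_elim, simp)
    show "AE x in lebesgue. x \<in> \<Omega> \<longrightarrow> \<bar>g x - \<Pi>g x\<bar> \<le> B" using main by eventually_elim simp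
  qed (rule B)
qed

lemma regular_mesh_nonempty:
  assumes "regular_mesh \<Omega> T" "\<Omega> \<noteq> {}"
  shows "T \<noteq> {}"
proof
  assume "T = {}"
  then have "closure \<Omega> = {}" using assms(1) by (auto simp: regular_mesh_def)
  then show False using assms(2) closure_subset[of \<Omega>] by blast
qed

lemma mesh_size_pos:
  assumes T: "regular_mesh \<Omega> T" and ne: "\<Omega> \<noteq> {}"
  shows "0 < mesh_size T" and "E \<in> T \<Longrightarrow> diameter (region E) \<le> mesh_size T"
proof -
  have fin: "finite T" and nd: "\<And>E. E \<in> T \<Longrightarrow> nondegenerate E"
    using T by (auto simp: regular_mesh_def)
  show le: "diameter (region E) \<le> mesh_size T" if "E \<in> T" for E
    unfolding mesh_size_def using fin that by (intro Max_ge) auto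
  obtain E where E: "E \<in> T" using regular_mesh_nonempty[OF T ne] by blast
  have "0 < edge_length E 1" by (rule edge_length_pos[OF nd[OF E]])
  also have "\<dots> \<le> diameter (region E)"
    unfolding edge_length_def by (intro dist_region_le_diameter vertex_in_region)
  also have "\<dots> \<le> mesh_size T" by (rule le[OF E])
  finally show "0 < mesh_size T" .
qed

lemma inverse_edge_moment_le_H:
  assumes "k \<in> {1..3}"
  shows "inverse \<bar>edge_moment \<alpha> \<beta> f k\<bar> \<le> H_const \<alpha> \<beta> f"
  unfolding H_const_def edge_moment_def using assms by (intro Max_ge) auto

lemma AE_le_K_const:
  assumes "l \<in> {1..6}"
  shows "AE t in lebesgue. t \<in> {0..1} \<longrightarrow> ennreal \<bar>f l t\<bar> \<le> K_const f"
proof -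
  have "esssup (lebesgue_on {0..1}) (\<lambda>t. ennreal \<bar>f l t\<bar>) \<le> K_const f"
    unfolding K_const_def using assms by (intro Max_ge) auto
  moreover have "AE t in lebesgue_on {0..1}. ennreal \<bar>f l t\<bar> \<le> esssup (lebesgue_on {0..1}) (\<lambda>t. ennreal \<bar>f l t\<bar>)"
    by (rule esssup_AE)
  ultimately have "AE t in lebesgue_on {0..1}. ennreal \<bar>f l t\<bar> \<le> K_const f"
    by (auto elim!: eventually_mono)
  then show ?thesis by (simp add: AE_restrict_space_iff)
qed

lemma measure_open_pos:
  assumes "open \<Omega>" "bounded \<Omega>" "\<Omega> \<noteq> {}"
  shows "0 < measure lebesgue (\<Omega> :: point set)"
proof -
  have "\<Omega> \<in> lmeasurable" using assms by (simp add: lmeasurable_open)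
  then have "measure lebesgue \<Omega> \<noteq> 0"
    using open_not_negligible[OF assms(1,3)] negligible_iff_measure0 by blast
  then show ?thesis using measure_nonneg[of lebesgue \<Omega>] by linarith
qed

lemma C_const_finite:
  assumes "0 \<le> lipschitz_const \<Omega> (grad g)" "0 \<le> \<mu>" "0 \<le> K" "0 \<le> H_const \<alpha> \<beta> f" "K_const f = ennreal K"
  shows "C_const \<mu> \<alpha> \<beta> f g \<Omega> * ennreal (h\<^sup>2) =
    ennreal (lipschitz_const \<Omega> (grad g) / 8 * h\<^sup>2 * (1 + 9 * (\<mu> + 1) / 2 * K\<^sup>2 * H_const \<alpha> \<beta> f)
      * sqrt (measure lebesgue \<Omega>))"
proof -
  have "ennreal a * (1 + ennreal m * (ennreal K)\<^sup>2 * ennreal (H_const \<alpha> \<beta> f)) * ennreal s * ennreal t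
      = ennreal (a * t * (1 + m * K\<^sup>2 * H_const \<alpha> \<beta> f) * s)"
    if "0 \<le> a" "0 \<le> m" "0 \<le> s" "0 \<le> t" for a m s t
  proof -
    define q where "q = 1 + m * K\<^sup>2 * H_const \<alpha> \<beta> f"
    have q: "0 \<le> q" using that assms by (simp add: q_def)
    have "1 + ennreal m * (ennreal K)\<^sup>2 * ennreal (H_const \<alpha> \<beta> f) = ennreal q"
      unfolding q_def using assms that by (simp add: ennreal_mult ennreal_power ennreal_plus)
    then show ?thesis
      using that q unfolding q_def[symmetric] by (simp add: ennreal_mult mult_ac)
  qed
  from this[of "lipschitz_const \<Omega> (grad g) / 8" "9 * (\<mu> + 1) / 2" "sqrt (measure lebesgue \<Omega>)" "h\<^sup>2"]
  show ?thesis using assms unfolding C_const_def by simp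
qed

text \<open>Each of the other factors is positive, hence does not annihilate the infinite one.\<close>

lemma C_const_infinite:
  assumes "0 < lipschitz_const \<Omega> (grad g)" "0 \<le> \<mu>" "0 < H_const \<alpha> \<beta> f" "K_const f = top"
    "0 < measure lebesgue \<Omega>" "0 < h"
  shows "C_const \<mu> \<alpha> \<beta> f g \<Omega> * ennreal (h\<^sup>2) = top"
  using assms unfolding C_const_def
  by (simp add: ennreal_mult_eq_top_iff power2_eq_square)

theorem theorem4p15:
  fixes \<Omega> :: "point set" and T :: "triangle set"
    and \<mu> \<alpha> \<beta> :: real and f :: "nat \<Rightarrow> real \<Rightarrow> real"
    and g \<Pi>g :: "point \<Rightarrow> real"
  assumes "lipschitz_domain \<Omega>"
    and "regular_mesh \<Omega> T"
    and "\<mu> > 0" "\<alpha> > 0" "\<beta> > 0" "\<mu> + \<alpha> + \<beta> = 1"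
    and "\<And>l. l \<in> {1..6} \<Longrightarrow> set_integrable lebesgue {0..1} (f l)"
    and "\<And>l. l \<in> {1..6} \<Longrightarrow> (\<forall>t\<in>{0..1}. 0 \<le> f l t) \<or> (\<forall>t\<in>{0..1}. f l t \<le> 0)"
    and "\<And>l. l \<in> {1..6} \<Longrightarrow> AE t in lebesgue_on {0..1}. f l t \<noteq> 0"
    and "\<And>l. l \<in> {1..6} \<Longrightarrow> f l 0 = 0"
    and "\<And>E. E \<in> T \<Longrightarrow> functionals_well_defined E (enrichment \<mu> \<alpha> \<beta> f E)"
    and "\<And>E. E \<in> T \<Longrightarrow> admissible E (enrichment \<mu> \<alpha> \<beta> f E)"
    and "C11 \<Omega> g"
    and "is_global_projection T (enrichment \<mu> \<alpha> \<beta> f) (closure_ext \<Omega> g) \<Pi>g"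
  shows "L2_norm \<Omega> (\<lambda>x. g x - \<Pi>g x)
           \<le> C_const \<mu> \<alpha> \<beta> f g \<Omega> * ennreal ((mesh_size T)\<^sup>2)"
proof -
  note par = assms(3-6) and f0 = assms(10)
  let ?e = "enrichment \<mu> \<alpha> \<beta> f" and ?G = "closure_ext \<Omega> g"
  let ?I = "edge_moment \<alpha> \<beta> f"
  define L h H where "L = lipschitz_const \<Omega> (grad g)" and "h = mesh_size T" and "H = H_const \<alpha> \<beta> f"
  define c where "c = L / 8 * h\<^sup>2"
  have \<Omega>: "open \<Omega>" "bounded \<Omega>" "\<Omega> \<noteq> {}" using assms(1) by (auto simp: lipschitz_domain_def)
  have nd: "nondegenerate E" and sub: "region E \<subseteq> closure \<Omega>" if "E \<in> T" for E
    using assms(2) that by (auto simp: regular_mesh_def)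
  have L: "0 \<le> L"
    unfolding L_def using assms(13)
    by (intro lipschitz_on_nonneg[OF lipschitz_const_lipschitz_on]) (simp add: C11_def)
  have h: "0 < h" unfolding h_def by (rule mesh_size_pos[OF assms(2) \<Omega>(3)])
  have c: "0 \<le> c" using L by (simp add: c_def)
  obtain E0 where E0: "E0 \<in> T" using regular_mesh_nonempty[OF assms(2) \<Omega>(3)] by blast
  have int: "set_integrable lebesgue {0..1} (\<lambda>t. t powr \<alpha> * (1 - t) powr \<beta> * f (2 * k - 1) t * f (2 * k) (1 - t))"
    if "k \<in> {1..3}" for k
    by (rule edge_moment_integrable[where f = f, OF nd[OF E0] f0 that assms(11)[OF E0]])
  have nz: "?I k \<noteq> 0" if "k \<in> {1..3}" for k
    by (rule edge_moment_nonzero[where f = f, OF int[OF that] assms(8,9) that])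
  have inv_le: "inverse \<bar>?I k\<bar> \<le> H" if "k \<in> {1..3}" for k
    unfolding H_def by (rule inverse_edge_moment_le_H[OF that])
  have "0 < inverse \<bar>?I 1\<bar>" using nz[of 1] by simp
  also have "\<dots> \<le> H" by (rule inv_le) simp
  finally have H: "0 < H" .
  have local: "\<bar>?G x - local_projector E (?e E) ?G x\<bar> \<le> 2 * c + (\<Sum>k=1..3. c / \<bar>?I k\<bar> * \<bar>?e E k x\<bar>)"
    if E: "E \<in> T" and x: "x \<in> region E" for E x
  proof (rule local_error[where f = f, OF nd[OF E] f0 assms(11)[OF E] assms(12)[OF E] nz _ _ x])
    show "continuous_on (region E) ?G"
      using closure_ext_continuous[OF assms(1,13)] sub[OF E] by (rule continuous_on_subset)
    show "\<bar>?G (linepath a b t) - ((1 - t) * ?G a + t * ?G b)\<bar> \<le> c"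
      if "a \<in> region E" "b \<in> region E" "t \<in> {0..1}" for a b t
    proof -
      have "0 \<le> diameter (region E)"
        by (rule diameter_ge_0[OF compact_imp_bounded[OF compact_region]])
      then have "L / 8 * (diameter (region E))\<^sup>2 \<le> c"
        unfolding c_def h_def using L mesh_size_pos(2)[OF assms(2) \<Omega>(3) E]
        by (intro mult_left_mono power_mono) auto
      then show ?thesis
        using chord_error_region[OF assms(1,13) nd[OF E] sub[OF E] that] unfolding L_def by linarith
    qed
  qed
  have L2: "L2_norm \<Omega> (\<lambda>x. g x - \<Pi>g x) \<le> ennreal (B * sqrt (measure lebesgue \<Omega>))"
    if B: "0 \<le> B" and B_bound: "\<And>E. E \<in> T \<Longrightarrow> AE x in lebesgue. x \<in> region E \<longrightarrow>
        2 * c + (\<Sum>k=1..3. c / \<bar>?I k\<bar> * \<bar>?e E k x\<bar>) \<le> B" for B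
  proof (rule L2_error_le[OF assms(1,2,13,14)])
    show "local_projector E (?e E) ?G \<in> borel_measurable (lebesgue_on (region E))" if "E \<in> T" for E
      by (rule borel_measurable_local_projector[where f = f, OF nd[OF that] assms(7) f0 assms(11)[OF that] assms(12)[OF that] nz])
    show "AE x in lebesgue. x \<in> region E \<longrightarrow> \<bar>?G x - local_projector E (?e E) ?G x\<bar> \<le> B" if E: "E \<in> T" for E
      using B_bound[OF E] by eventually_elim (use local[OF E] in \<open>auto intro: order_trans\<close>)
  qed (rule B)
  show ?thesis
  proof (cases "K_const f = top")
    case True
    show ?thesis
    proof (cases "L = 0")
      case L0: True
      have "L2_norm \<Omega> (\<lambda>x. g x - \<Pi>g x) \<le> ennreal (0 * sqrt (measure lebesgue \<Omega>))"
        by (rule L2) (simp_all add: c_def L0)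
      then show ?thesis by simp
    next
      case False
      then have "C_const \<mu> \<alpha> \<beta> f g \<Omega> * ennreal (h\<^sup>2) = top"
        using L H h par measure_open_pos[OF \<Omega>] True
        by (intro C_const_infinite) (auto simp: L_def H_def)
      then show ?thesis by (simp add: h_def)
    qed
  next
    case False
    define K where "K = enn2real (K_const f)"
    have K: "0 \<le> K" "K_const f = ennreal K"
      using False by (simp_all add: K_def less_top)
    have fK: "AE t in lebesgue. t \<in> {0..1} \<longrightarrow> \<bar>f l t\<bar> \<le> K" if "l \<in> {1..6}" for l
      using AE_le_K_const[OF that, of f] by (simp add: K)
    have "\<bar>?I 1\<bar> \<le> K\<^sup>2"
      using par by (intro edge_moment_le int fK) auto
    then have "1 \<le> K\<^sup>2 * inverse \<bar>?I 1\<bar>"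
      using nz[of 1] by (simp add: field_simps)
    also have "\<dots> \<le> K\<^sup>2 * H" using inv_le[of 1] by (intro mult_left_mono) auto
    finally have KH: "1 \<le> K\<^sup>2 * H" .
    define B where "B = c * (1 + 9 * (\<mu> + 1) / 2 * K\<^sup>2 * H)"
    have "L2_norm \<Omega> (\<lambda>x. g x - \<Pi>g x) \<le> ennreal (B * sqrt (measure lebesgue \<Omega>))"
    proof (rule L2)
      show "0 \<le> B" using c par H by (simp add: B_def)
      fix E assume E: "E \<in> T"
      have e_bound: "AE x in lebesgue. x \<in> region E \<longrightarrow> \<bar>?e E k x\<bar> \<le> (\<mu> + 1) * K\<^sup>2"
        if "k \<in> {1..3}" for k
        by (rule enrichment_bound[where f = f, OF nd[OF E] par fK that])
      from e_bound[of 1] e_bound[of 2] e_bound[of 3]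
      have "AE x in lebesgue. \<forall>k\<in>{1..3}. x \<in> region E \<longrightarrow> \<bar>?e E k x\<bar> \<le> (\<mu> + 1) * K\<^sup>2"
        unfolding ball_1_3 by simp
      then show "AE x in lebesgue. x \<in> region E \<longrightarrow> 2 * c + (\<Sum>k=1..3. c / \<bar>?I k\<bar> * \<bar>?e E k x\<bar>) \<le> B"
      proof eventually_elim
        case (elim x)
        show ?case
        proof
          assume "x \<in> region E"
          then have "(\<Sum>k=1..3. c / \<bar>?I k\<bar> * \<bar>?e E k x\<bar>) \<le> (\<Sum>k=1..3::nat. (c * H) * ((\<mu> + 1) * K\<^sup>2))"
            using c H elim inv_le unfolding divide_inverse
            by (intro sum_mono mult_mono mult_left_mono) auto
          then have "2 * c + (\<Sum>k=1..3. c / \<bar>?I k\<bar> * \<bar>?e E k x\<bar>) \<le> c * (2 + 3 * (\<mu> + 1) * (K\<^sup>2 * H))"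
            by (simp add: algebra_simps)
          (* Half of 3 (\<mu> + 1) K\<^sup>2 H is at least 1, which absorbs the surplus of the interpolation error. *)
          also have "\<dots> \<le> c * (1 + 9 * (\<mu> + 1) / 2 * (K\<^sup>2 * H))"
          proof (rule mult_left_mono[OF _ c])
            have "1 \<le> (\<mu> + 1) * (K\<^sup>2 * H)"
              using mult_mono[of 1 "\<mu> + 1" 1 "K\<^sup>2 * H"] KH par by simp
            then show "2 + 3 * (\<mu> + 1) * (K\<^sup>2 * H) \<le> 1 + 9 * (\<mu> + 1) / 2 * (K\<^sup>2 * H)"
              by (simp add: algebra_simps)
          qed
          also have "\<dots> = B" by (simp add: B_def mult.assoc)
          finally show "2 * c + (\<Sum>k=1..3. c / \<bar>?I k\<bar> * \<bar>?e E k x\<bar>) \<le> B" .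
        qed
      qed
    qed
    also have "ennreal (B * sqrt (measure lebesgue \<Omega>)) = C_const \<mu> \<alpha> \<beta> f g \<Omega> * ennreal (h\<^sup>2)"
      using L H par K by (subst C_const_finite[where K = K]) (auto simp: L_def H_def B_def c_def)
    finally show ?thesis by (simp add: h_def)
  qed
qed

end
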